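(* Let $K$ be a field. The category $\mathbf{BX}(\mathbf{AssAlg}_K)$ of braided crossed modules of associative $K$-algebras and the category $\mathbf{BICat}(\mathbf{AssAlg}_K)$ of braided categorical associative $K$-algebras are equivalent. Further, the functors $\mathcal{C}_{\mathfrak{A}}\colon \mathbf{BX}(\mathbf{AssAlg}_K)\to\mathbf{BICat}(\mathbf{AssAlg}_K)$ and $\mathcal{X}_{\mathfrak{A}}\colon \mathbf{BICat}(\mathbf{AssAlg}_K)\to\mathbf{BX}(\mathbf{AssAlg}_K)$ (defined in the context) are inverse equivalences, where the natural isomorphisms $\alpha^{\mathfrak A}\colon \mathrm{Id}_{\mathbf{BX}(\mathbf{AssAlg}_K)}\cong \mathcal{X}_{\mathfrak A}\circ\mathcal{C}_{\mathfrak A}$ and $\beta^{\mathfrak A}\colon \mathrm{Id}_{\mathbf{BICat}(\mathbf{AssAlg}_K)}\cong \mathcal{C}_{\mathfrak A}\circ\mathcal{X}_{\mathfrak A}$ are given as follows. (1) If $\mathcal{Z}=(M,N,(\cdot_1,\cdot_2),\partial,\{-,-\})$ is a braided crossed module of associative $K$-algebras, then $\alpha^{\mathfrak A}_{\mathcal Z}=(\alpha^{\mathfrak A}_M,\mathrm{Id}_N)$, where $\alpha^{\mathfrak A}_M\colon M\to (M,0):=\{(m,0)\in M\rtimes N\mid m\in M\}$ is defined by $\alpha^{\mathfrak A}_M(m)=(m,0)$. (2) If $\mathcal{D}=(C_1,C_0,s,t,e,k,\tau)$ is a braided categorical associative $K$-algebra, then $\beta^{\mathfrak A}_{\mathcal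 D}=(\beta^{\mathfrak A}_{C_1},\mathrm{Id}_{C_0})$, where $\beta^{\mathfrak A}_{C_1}\colon C_1\to\ker(s)\rtimes C_0$ is defined by $\beta^{\mathfrak A}_{C_1}(x)=(x-e(s(x)),s(x))$.
   Context: $K$ is a field. Associative $K$-algebras are $K$-vector spaces with an associative $K$-bilinear product (not necessarily unital); homomorphisms are $K$-linear multiplicative maps. Associative action. An associative action of $N$ on $M$ is a pair $*=( *_1,*_2)$ of $K$-bilinear maps $*_1\colon N\times M\to M$, $*_2\colon M\times N\to M$ such that for all $m,m'\in M$, $n,n'\in N$: $n*_1(mm')=(n*_1m)m'$, $n*_1(m*_2n')=(n*_1m)*_2n'$, $n*_1(n'*_1m)=(nn')*_1m$, $m*_2(nn')=(m*_2n)*_2n'$, $m(n*_1m')=(m*_2n)m'$, $m(m'*_2n)=(mm')*_2n$. The semidirect product $M\rtimes N$ is the vector space $M\times N$ with product $(m,n)(m',n')=(mm'+n*_1m'+m*_2n',\,nn')$. Crossed module. A crossed module of associative $K$-algebras $(M,N,*,\partial)$ consists of associative algebras $M,N$, an associative action $*=( *_1,*_2)$ of $N$ on $M$ and a homomorphism $\partial\colon M\to N$ with $\partial(n*_1m)=n\partial(m)$, $\partial(m*_2n)=\partial(m)n$, $\partial(m)*_1m'=mm'=m*_2\partial(m')$. A homomorphism $(M,N,\cdot,\partial)\to(M',N',*,\partial')$ is a pair of algebra homomorphisms $f_1\colon M\to M'$, $f_2\colon N\to N'$ with $f_1(n\cdot_1m)=f_2(n)*_1f_1(m)$, $f_1(m\cdot_2n)=f_1(m)*_2f_2(n)$,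 $\partial' f_1=f_2\partial$. Braided crossed module. With $[n,m]_*=n*_1m-m*_2n$ and $[x,y]=xy-yx$, a braiding on $(M,N,*,\partial)$ is a $K$-bilinear map $\{-,-\}\colon N\times N\to M$ such that for all $m,m'\in M$, $n,n',n''\in N$: $\partial\{n,n'\}=[n,n']$; $\{\partial m,\partial m'\}=[m,m']$; $\{\partial m,n\}=-[n,m]_*$; $\{n,\partial m\}=[n,m]_*$; $\{n,n'n''\}=n'*_1\{n,n''\}+\{n,n'\}*_2n''$; $\{nn',n''\}=n*_1\{n',n''\}+\{n,n''\}*_2n'$. Morphisms of braided crossed modules are homomorphisms of crossed modules with $f_1(\{n,n'\})=\{f_2(n),f_2(n')\}'$. This gives $\mathbf{BX}(\mathbf{AssAlg}_K)$. Categorical associative algebra. This is an internal category in associative $K$-algebras: associative algebras $C_1,C_0$ and homomorphisms $s,t\colon C_1\to C_0$, $e\colon C_0\to C_1$, $k\colon C_1\times_{C_0}C_1\to C_1$, with $C_1\times_{C_0}C_1=\{(x,y): t(x)=s(y)\}$, satisfying $se=te=\mathrm{Id}$, $s(k(x,y))=s(x)$, $t(k(x,y))=t(y)$, $k(e(s(x)),x)=x=k(x,e(t(x)))$, and associativity of $k$. Write $y\circ x=k((x,y))$, and $x\colon a\to b$ when $s(x)=a$, $t(x)=b$. An internal functor $(F_1,F_0)$ is a pair of homomorphisms $F_1\colon C_1\to C_1'$, $F_0\colon C_0\to C_0'$ commuting with $s,t,e,k$. Braided categorical associative algebra. A braiding is a $K$-bilinear map $\tau\colon C_0\times C_0\to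 C_1$, $(a,b)\mapsto\tau_{a,b}$, such that for $a,b,c\in C_0$, $x,y\in C_1$: $\tau_{a,b}\colon ab\to ba$; $\tau_{t(x),t(y)}\circ(xy)=(yx)\circ\tau_{s(x),s(y)}$; $\tau_{ab,c}=(\tau_{a,c}e(b))\circ(e(a)\tau_{b,c})$; $\tau_{a,bc}=(e(b)\tau_{a,c})\circ(\tau_{a,b}e(c))$. Morphisms (braided internal functors) are internal functors with $F_1(\tau_{a,b})=\tau'_{F_0(a),F_0(b)}$. This gives $\mathbf{BICat}(\mathbf{AssAlg}_K)$. Functor $\mathcal{C}_{\mathfrak A}$. It sends $\mathcal{X}=(M,N,( *_1,*_2),\partial,\{-,-\})$ to $(M\rtimes N,N,\bar s,\bar t,\bar e,\bar k,\bar\tau)$ with $\bar s(m,n)=n$, $\bar t(m,n)=\partial m+n$, $\bar e(n)=(0,n)$, $\bar k((m,n),(m',\partial m+n))=(m+m',n)$, $\bar\tau_{n,n'}=(-\{n,n'\},nn')$, and sends $(f_1,f_2)$ to $(f_1\times f_2,f_2)$. Functor $\mathcal{X}_{\mathfrak A}$. It sends $(C_1,C_0,s,t,e,k,\tau)$ to $(\ker(s),C_0,({}^e*,*^e),\partial_t,\{-,-\}_\tau)$ with $a\,{}^e{*}\,x=e(a)x$, $x*^ea=xe(a)$, $\partial_t=t|_{\ker(s)}$, $\{a,b\}_\tau=e(ab)-\tau_{a,b}$, and sends $(F_1,F_0)$ to $(F_1^s,F_0)$ with $F_1^s\colon\ker(s)\to\ker(s')$ the restriction of $F_1$. *)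

theory Defs
  imports "HOL-Algebra.Module"
begin

section \<open>Categories, functors and equivalences\<close>

text \<open>Arrows are not required to determine their domain and codomain, so composition, identities
  and the arrow part of a functor are indexed by objects:
  \<open>Cmp A X Y Z g f\<close> is \<open>g\<close> after \<open>f\<close> for \<open>f : X \<rightarrow> Y\<close> and \<open>g : Y \<rightarrow> Z\<close>.\<close>

record ('o, 'm) cat =
  Ob :: "'o set"
  Hom :: "'o \<Rightarrow> 'o \<Rightarrow> 'm set"
  Idn :: "'o \<Rightarrow> 'm"
  Cmp :: "'o \<Rightarrow> 'o \<Rightarrow> 'o \<Rightarrow> 'm \<Rightarrow> 'm \<Rightarrow> 'm"

locale category =
  fixes A :: "('o, 'm) cat"
  assumes Idn_in_Hom: "X \<in> Ob A \<Longrightarrow> Idn A X \<in> Hom A X X"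
    and Cmp_in_Hom: "\<lbrakk>X \<in> Ob A; Y \<in> Ob A; Z \<in> Ob A; f \<in> Hom A X Y; g \<in> Hom A Y Z\<rbrakk>
      \<Longrightarrow> Cmp A X Y Z g f \<in> Hom A X Z"
    and Idn_left: "\<lbrakk>X \<in> Ob A; Y \<in> Ob A; f \<in> Hom A X Y\<rbrakk> \<Longrightarrow> Cmp A X Y Y (Idn A Y) f = f"
    and Idn_right: "\<lbrakk>X \<in> Ob A; Y \<in> Ob A; f \<in> Hom A X Y\<rbrakk> \<Longrightarrow> Cmp A X X Y f (Idn A X) = f"
    and Cmp_assoc: "\<lbrakk>W \<in> Ob A; X \<in> Ob A; Y \<in> Ob A; Z \<in> Ob A;
        f \<in> Hom A W X; g \<in> Hom A X Y; h \<in> Hom A Y Z\<rbrakk>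
      \<Longrightarrow> Cmp A W X Z (Cmp A X Y Z h g) f = Cmp A W Y Z h (Cmp A W X Y g f)"

definition is_isomorphism :: "('o, 'm) cat \<Rightarrow> 'o \<Rightarrow> 'o \<Rightarrow> 'm \<Rightarrow> bool" where
  "is_isomorphism A X Y f \<longleftrightarrow> f \<in> Hom A X Y \<and>
     (\<exists>g \<in> Hom A Y X. Cmp A X Y X g f = Idn A X \<and> Cmp A Y X Y f g = Idn A Y)"

record ('o1, 'm1, 'o2, 'm2) fctr =
  on_ob :: "'o1 \<Rightarrow> 'o2"
  on_ar :: "'o1 \<Rightarrow> 'o1 \<Rightarrow> 'm1 \<Rightarrow> 'm2"

locale cat_functor = A: category A + B: category B
  for A :: "('o1, 'm1) cat" and B :: "('o2, 'm2) cat" +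
  fixes F :: "('o1, 'm1, 'o2, 'm2) fctr"
  assumes on_ob: "X \<in> Ob A \<Longrightarrow> on_ob F X \<in> Ob B"
    and on_ar: "\<lbrakk>X \<in> Ob A; Y \<in> Ob A; f \<in> Hom A X Y\<rbrakk>
      \<Longrightarrow> on_ar F X Y f \<in> Hom B (on_ob F X) (on_ob F Y)"
    and on_Idn: "X \<in> Ob A \<Longrightarrow> on_ar F X X (Idn A X) = Idn B (on_ob F X)"
    and on_Cmp: "\<lbrakk>X \<in> Ob A; Y \<in> Ob A; Z \<in> Ob A; f \<in> Hom A X Y; g \<in> Hom A Y Z\<rbrakk>
      \<Longrightarrow> on_ar F X Z (Cmp A X Y Z g f)
        = Cmp B (on_ob F X) (on_ob F Y) (on_ob F Z) (on_ar F Y Z g) (on_ar F X Y f)"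

definition fctr_id :: "('o, 'm, 'o, 'm) fctr" where
  "fctr_id = \<lparr>on_ob = (\<lambda>X. X), on_ar = (\<lambda>X Y f. f)\<rparr>"

definition fctr_comp ::
  "('o2, 'm2, 'o3, 'm3) fctr \<Rightarrow> ('o1, 'm1, 'o2, 'm2) fctr \<Rightarrow> ('o1, 'm1, 'o3, 'm3) fctr" where
  "fctr_comp G F = \<lparr>on_ob = (\<lambda>X. on_ob G (on_ob F X)),
     on_ar = (\<lambda>X Y f. on_ar G (on_ob F X) (on_ob F Y) (on_ar F X Y f))\<rparr>"

locale natural_isomorphism = F: cat_functor A B F + G: cat_functor A B G
  for A :: "('o1, 'm1) cat" and B :: "('o2, 'm2) cat" and F G +
  fixes \<eta> :: "'o1 \<Rightarrow> 'm2"
  assumes component_iso: "X \<in> Ob A \<Longrightarrow> is_isomorphism B (on_ob F X) (on_ob G X) (\<eta> X)"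
    and naturality: "\<lbrakk>X \<in> Ob A; Y \<in> Ob A; f \<in> Hom A X Y\<rbrakk>
      \<Longrightarrow> Cmp B (on_ob F X) (on_ob F Y) (on_ob G Y) (\<eta> Y) (on_ar F X Y f)
        = Cmp B (on_ob F X) (on_ob G X) (on_ob G Y) (on_ar G X Y f) (\<eta> X)"

locale inverse_equivalences = F: cat_functor A B F + G: cat_functor B A G
  for A :: "('o1, 'm1) cat" and B :: "('o2, 'm2) cat" and F G +
  fixes \<alpha> :: "'o1 \<Rightarrow> 'm1" and \<beta> :: "'o2 \<Rightarrow> 'm2"
  assumes unit: "natural_isomorphism A A fctr_id (fctr_comp G F) \<alpha>"
    and counit: "natural_isomorphism B B fctr_id (fctr_comp F G) \<beta>"

definition equivalent_categories :: "('o1, 'm1) cat \<Rightarrow> ('o2, 'm2) cat \<Rightarrow> bool" where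
  "equivalent_categories A B \<longleftrightarrow> (\<exists>F G \<alpha> \<beta>. inverse_equivalences A B F G \<alpha> \<beta>)"


section \<open>Associative algebras\<close>

definition bilinear_map ::
  "('k, 'z) ring_scheme \<Rightarrow> ('k, 'a) module \<Rightarrow> ('k, 'b) module \<Rightarrow> ('k, 'c) module
    \<Rightarrow> ('a \<Rightarrow> 'b \<Rightarrow> 'c) \<Rightarrow> bool" where
  "bilinear_map K A B C f \<longleftrightarrow>
     f \<in> carrier A \<rightarrow> carrier B \<rightarrow> carrier C \<and>
     (\<forall>x\<in>carrier A. \<forall>x'\<in>carrier A. \<forall>y\<in>carrier B. f (x \<oplus>\<^bsub>A\<^esub> x') y = f x y \<oplus>\<^bsub>C\<^esub> f x' y) \<and>
     (\<forall>x\<in>carrier A. \<forall>y\<in>carrier B. \<forall>y'\<in>carrier B. f x (y \<oplus>\<^bsub>B\<^esub> y') = f x y \<oplus>\<^bsub>C\<^esub> f x y') \<and>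
     (\<forall>r\<in>carrier K. \<forall>x\<in>carrier A. \<forall>y\<in>carrier B. f (r \<odot>\<^bsub>A\<^esub> x) y = r \<odot>\<^bsub>C\<^esub> f x y) \<and>
     (\<forall>r\<in>carrier K. \<forall>x\<in>carrier A. \<forall>y\<in>carrier B. f x (r \<odot>\<^bsub>B\<^esub> y) = r \<odot>\<^bsub>C\<^esub> f x y)"

text \<open>Algebras need not be unital or commutative, so the library locale \<open>algebra\<close> does not apply.
  The \<open>one\<close> slot of the record is unused: nothing is assumed about it and homomorphisms ignore it.\<close>

locale assoc_algebra = module K A for K (structure) and A (structure) +
  assumes mult_bilinear: "bilinear_map K A A A (mult A)"
    and mult_assoc: "\<lbrakk>x \<in> carrier A; y \<in> carrier A; z \<in> carrier A\<rbrakk>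
      \<Longrightarrow> (x \<otimes>\<^bsub>A\<^esub> y) \<otimes>\<^bsub>A\<^esub> z = x \<otimes>\<^bsub>A\<^esub> (y \<otimes>\<^bsub>A\<^esub> z)"

definition alg_hom ::
  "('k, 'z) ring_scheme \<Rightarrow> ('k, 'a) module \<Rightarrow> ('k, 'b) module \<Rightarrow> ('a \<Rightarrow> 'b) set" where
  "alg_hom K A B = {f. f \<in> carrier A \<rightarrow> carrier B \<and>
     (\<forall>x\<in>carrier A. \<forall>y\<in>carrier A. f (x \<oplus>\<^bsub>A\<^esub> y) = f x \<oplus>\<^bsub>B\<^esub> f y) \<and>
     (\<forall>r\<in>carrier K. \<forall>x\<in>carrier A. f (r \<odot>\<^bsub>A\<^esub> x) = r \<odot>\<^bsub>B\<^esub> f x) \<and>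
     (\<forall>x\<in>carrier A. \<forall>y\<in>carrier A. f (x \<otimes>\<^bsub>A\<^esub> y) = f x \<otimes>\<^bsub>B\<^esub> f y)}"

definition commutator :: "('k, 'a) module \<Rightarrow> 'a \<Rightarrow> 'a \<Rightarrow> 'a" where
  "commutator A x y = (x \<otimes>\<^bsub>A\<^esub> y) \<ominus>\<^bsub>A\<^esub> (y \<otimes>\<^bsub>A\<^esub> x)"

locale assoc_action = M: assoc_algebra K M + N: assoc_algebra K N
  for K (structure) and M :: "('k, 'm) module" and N :: "('k, 'n) module" +
  fixes l :: "'n \<Rightarrow> 'm \<Rightarrow> 'm" and r :: "'m \<Rightarrow> 'n \<Rightarrow> 'm"
  assumes l_bilinear: "bilinear_map K N M M l"
    and r_bilinear: "bilinear_map K M N M r"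
    and l_mult: "\<lbrakk>n \<in> carrier N; m \<in> carrier M; m' \<in> carrier M\<rbrakk>
      \<Longrightarrow> l n (m \<otimes>\<^bsub>M\<^esub> m') = l n m \<otimes>\<^bsub>M\<^esub> m'"
    and l_r: "\<lbrakk>n \<in> carrier N; m \<in> carrier M; n' \<in> carrier N\<rbrakk>
      \<Longrightarrow> l n (r m n') = r (l n m) n'"
    and l_l: "\<lbrakk>n \<in> carrier N; n' \<in> carrier N; m \<in> carrier M\<rbrakk>
      \<Longrightarrow> l n (l n' m) = l (n \<otimes>\<^bsub>N\<^esub> n') m"
    and r_r: "\<lbrakk>m \<in> carrier M; n \<in> carrier N; n' \<in> carrier N\<rbrakk>
      \<Longrightarrow> r m (n \<otimes>\<^bsub>N\<^esub> n') = r (r m n) n'"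
    and mult_l: "\<lbrakk>m \<in> carrier M; n \<in> carrier N; m' \<in> carrier M\<rbrakk>
      \<Longrightarrow> m \<otimes>\<^bsub>M\<^esub> l n m' = r m n \<otimes>\<^bsub>M\<^esub> m'"
    and mult_r: "\<lbrakk>m \<in> carrier M; m' \<in> carrier M; n \<in> carrier N\<rbrakk>
      \<Longrightarrow> m \<otimes>\<^bsub>M\<^esub> r m' n = r (m \<otimes>\<^bsub>M\<^esub> m') n"


section \<open>Braided crossed modules\<close>

locale crossed_module = assoc_action K M N l r
  for K (structure) and M :: "('k, 'm) module" and N :: "('k, 'n) module" and l r +
  fixes d :: "'m \<Rightarrow> 'n"
  assumes d_hom: "d \<in> alg_hom K M N"
    and d_l: "\<lbrakk>n \<in> carrier N; m \<in> carrier M\<rbrakk> \<Longrightarrow> d (l n m) = n \<otimes>\<^bsub>N\<^esub> d m"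
    and d_r: "\<lbrakk>m \<in> carrier M; n \<in> carrier N\<rbrakk> \<Longrightarrow> d (r m n) = d m \<otimes>\<^bsub>N\<^esub> n"
    and peiffer_l: "\<lbrakk>m \<in> carrier M; m' \<in> carrier M\<rbrakk> \<Longrightarrow> l (d m) m' = m \<otimes>\<^bsub>M\<^esub> m'"
    and peiffer_r: "\<lbrakk>m \<in> carrier M; m' \<in> carrier M\<rbrakk> \<Longrightarrow> m \<otimes>\<^bsub>M\<^esub> m' = r m (d m')"
begin

abbreviation act_commutator :: "'n \<Rightarrow> 'm \<Rightarrow> 'm" where
  "act_commutator n m \<equiv> l n m \<ominus>\<^bsub>M\<^esub> r m n"

end

locale braided_crossed_module = crossed_module K M N l r d
  for K (structure) and M :: "('k, 'm) module" and N :: "('k, 'n) module" and l r d +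
  fixes br :: "'n \<Rightarrow> 'n \<Rightarrow> 'm"
  assumes br_bilinear: "bilinear_map K N N M br"
    and d_br: "\<lbrakk>n \<in> carrier N; n' \<in> carrier N\<rbrakk> \<Longrightarrow> d (br n n') = commutator N n n'"
    and br_d_d: "\<lbrakk>m \<in> carrier M; m' \<in> carrier M\<rbrakk> \<Longrightarrow> br (d m) (d m') = commutator M m m'"
    and br_d_left: "\<lbrakk>m \<in> carrier M; n \<in> carrier N\<rbrakk> \<Longrightarrow> br (d m) n = \<ominus>\<^bsub>M\<^esub> act_commutator n m"
    and br_d_right: "\<lbrakk>n \<in> carrier N; m \<in> carrier M\<rbrakk> \<Longrightarrow> br n (d m) = act_commutator n m"
    and br_mult_right: "\<lbrakk>n \<in> carrier N; n' \<in> carrier N; n'' \<in> carrier N\<rbrakk>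
      \<Longrightarrow> br n (n' \<otimes>\<^bsub>N\<^esub> n'') = l n' (br n n'') \<oplus>\<^bsub>M\<^esub> r (br n n') n''"
    and br_mult_left: "\<lbrakk>n \<in> carrier N; n' \<in> carrier N; n'' \<in> carrier N\<rbrakk>
      \<Longrightarrow> br (n \<otimes>\<^bsub>N\<^esub> n') n'' = l n (br n' n'') \<oplus>\<^bsub>M\<^esub> r (br n n'') n'"

record ('k, 'm, 'n) bxmod =
  xM :: "('k, 'm) module"
  xN :: "('k, 'n) module"
  lact :: "'n \<Rightarrow> 'm \<Rightarrow> 'm"
  ract :: "'m \<Rightarrow> 'n \<Rightarrow> 'm"
  bdry :: "'m \<Rightarrow> 'n"
  brace :: "'n \<Rightarrow> 'n \<Rightarrow> 'm"

text \<open>Arrows of the categories below are extensional functions, so that they are equal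
  as soon as they agree on the carriers.\<close>

definition bxmod_hom :: "('k, 'z) ring_scheme \<Rightarrow> ('k, 'm, 'n) bxmod \<Rightarrow> ('k, 'm2, 'n2) bxmod
    \<Rightarrow> (('m \<Rightarrow> 'm2) \<times> ('n \<Rightarrow> 'n2)) set" where
  "bxmod_hom K X Y = {(f1, f2).
     f1 \<in> alg_hom K (xM X) (xM Y) \<inter> extensional (carrier (xM X)) \<and>
     f2 \<in> alg_hom K (xN X) (xN Y) \<inter> extensional (carrier (xN X)) \<and>
     (\<forall>n\<in>carrier (xN X). \<forall>m\<in>carrier (xM X). f1 (lact X n m) = lact Y (f2 n) (f1 m)) \<and>
     (\<forall>m\<in>carrier (xM X). \<forall>n\<in>carrier (xN X). f1 (ract X m n) = ract Y (f1 m) (f2 n)) \<and>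
     (\<forall>m\<in>carrier (xM X). bdry Y (f1 m) = f2 (bdry X m)) \<and>
     (\<forall>n\<in>carrier (xN X). \<forall>n'\<in>carrier (xN X). f1 (brace X n n') = brace Y (f2 n) (f2 n'))}"

type_synonym ('k, 'm, 'n) bxmod_cat = "(('k, 'm, 'n) bxmod, ('m \<Rightarrow> 'm) \<times> ('n \<Rightarrow> 'n)) cat"

definition BX :: "('k, 'z) ring_scheme \<Rightarrow> ('k, 'm, 'n) bxmod_cat" where
  "BX K = \<lparr>
     Ob = {X. braided_crossed_module K (xM X) (xN X) (lact X) (ract X) (bdry X) (brace X)},
     Hom = bxmod_hom K,
     Idn = (\<lambda>X. (\<lambda>m\<in>carrier (xM X). m, \<lambda>n\<in>carrier (xN X). n)),
     Cmp = (\<lambda>X Y Z (g1, g2) (f1, f2).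
       (compose (carrier (xM X)) g1 f1, compose (carrier (xN X)) g2 f2))\<rparr>"


section \<open>Braided categorical associative algebras\<close>

text \<open>\<open>pullback_alg C1 s t\<close> is the fibre product of \<open>t\<close> and \<open>s\<close>, i.e. the algebra of
  composable pairs \<open>(x, y)\<close> with \<open>t x = s y\<close>.\<close>

definition pullback_alg ::
  "('k, 'c1) module \<Rightarrow> ('c1 \<Rightarrow> 'c0) \<Rightarrow> ('c1 \<Rightarrow> 'c0) \<Rightarrow> ('k, 'c1 \<times> 'c1) module" where
  "pullback_alg C1 s t = \<lparr>
     carrier = {(x, y). x \<in> carrier C1 \<and> y \<in> carrier C1 \<and> t x = s y},
     mult = (\<lambda>(x, y) (x', y'). (x \<otimes>\<^bsub>C1\<^esub> x', y \<otimes>\<^bsub>C1\<^esub> y')),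
     one = undefined,
     zero = (\<zero>\<^bsub>C1\<^esub>, \<zero>\<^bsub>C1\<^esub>),
     add = (\<lambda>(x, y) (x', y'). (x \<oplus>\<^bsub>C1\<^esub> x', y \<oplus>\<^bsub>C1\<^esub> y')),
     smult = (\<lambda>a (x, y). (a \<odot>\<^bsub>C1\<^esub> x, a \<odot>\<^bsub>C1\<^esub> y))\<rparr>"

locale categorical_assoc_algebra = C1: assoc_algebra K C1 + C0: assoc_algebra K C0
  for K (structure) and C1 :: "('k, 'c1) module" and C0 :: "('k, 'c0) module" +
  fixes s t :: "'c1 \<Rightarrow> 'c0" and e :: "'c0 \<Rightarrow> 'c1" and k :: "'c1 \<times> 'c1 \<Rightarrow> 'c1"
  assumes s_hom: "s \<in> alg_hom K C1 C0"
    and t_hom: "t \<in> alg_hom K C1 C0"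
    and e_hom: "e \<in> alg_hom K C0 C1"
    and k_hom: "k \<in> alg_hom K (pullback_alg C1 s t) C1"
    and s_e: "a \<in> carrier C0 \<Longrightarrow> s (e a) = a"
    and t_e: "a \<in> carrier C0 \<Longrightarrow> t (e a) = a"
    and s_k: "(x, y) \<in> carrier (pullback_alg C1 s t) \<Longrightarrow> s (k (x, y)) = s x"
    and t_k: "(x, y) \<in> carrier (pullback_alg C1 s t) \<Longrightarrow> t (k (x, y)) = t y"
    and k_e_left: "x \<in> carrier C1 \<Longrightarrow> k (e (s x), x) = x"
    and k_e_right: "x \<in> carrier C1 \<Longrightarrow> k (x, e (t x)) = x"
    and k_assoc: "\<lbrakk>(x, y) \<in> carrier (pullback_alg C1 s t); (y, z) \<in> carrier (pullback_alg C1 s t)\<rbrakk>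
      \<Longrightarrow> k (k (x, y), z) = k (x, k (y, z))"
begin

abbreviation after :: "'c1 \<Rightarrow> 'c1 \<Rightarrow> 'c1" (infixl "\<bullet>" 60) where
  "y \<bullet> x \<equiv> k (x, y)"

end

locale braided_categorical_assoc_algebra = categorical_assoc_algebra K C1 C0 s t e k
  for K (structure) and C1 :: "('k, 'c1) module" and C0 :: "('k, 'c0) module" and s t e k +
  fixes \<tau> :: "'c0 \<Rightarrow> 'c0 \<Rightarrow> 'c1"
  assumes \<tau>_bilinear: "bilinear_map K C0 C0 C1 \<tau>"
    and s_\<tau>: "\<lbrakk>a \<in> carrier C0; b \<in> carrier C0\<rbrakk> \<Longrightarrow> s (\<tau> a b) = a \<otimes>\<^bsub>C0\<^esub> b"
    and t_\<tau>: "\<lbrakk>a \<in> carrier C0; b \<in> carrier C0\<rbrakk> \<Longrightarrow> t (\<tau> a b) = b \<otimes>\<^bsub>C0\<^esub> a"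
    and \<tau>_natural: "\<lbrakk>x \<in> carrier C1; y \<in> carrier C1\<rbrakk>
      \<Longrightarrow> \<tau> (t x) (t y) \<bullet> (x \<otimes>\<^bsub>C1\<^esub> y) = (y \<otimes>\<^bsub>C1\<^esub> x) \<bullet> \<tau> (s x) (s y)"
    and \<tau>_mult_left: "\<lbrakk>a \<in> carrier C0; b \<in> carrier C0; c \<in> carrier C0\<rbrakk>
      \<Longrightarrow> \<tau> (a \<otimes>\<^bsub>C0\<^esub> b) c = (\<tau> a c \<otimes>\<^bsub>C1\<^esub> e b) \<bullet> (e a \<otimes>\<^bsub>C1\<^esub> \<tau> b c)"
    and \<tau>_mult_right: "\<lbrakk>a \<in> carrier C0; b \<in> carrier C0; c \<in> carrier C0\<rbrakk>
      \<Longrightarrow> \<tau> a (b \<otimes>\<^bsub>C0\<^esub> c) = (e b \<otimes>\<^bsub>C1\<^esub> \<tau> a c) \<bullet> (\<tau> a b \<otimes>\<^bsub>C1\<^esub> e c)"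

record ('k, 'c1, 'c0) bicat =
  arrs :: "('k, 'c1) module"
  objs :: "('k, 'c0) module"
  src :: "'c1 \<Rightarrow> 'c0"
  tgt :: "'c1 \<Rightarrow> 'c0"
  unt :: "'c0 \<Rightarrow> 'c1"
  cmp :: "'c1 \<times> 'c1 \<Rightarrow> 'c1"
  twist :: "'c0 \<Rightarrow> 'c0 \<Rightarrow> 'c1"

definition bicat_hom :: "('k, 'z) ring_scheme \<Rightarrow> ('k, 'c1, 'c0) bicat \<Rightarrow> ('k, 'd1, 'd0) bicat
    \<Rightarrow> (('c1 \<Rightarrow> 'd1) \<times> ('c0 \<Rightarrow> 'd0)) set" where
  "bicat_hom K C D = {(F1, F0).
     F1 \<in> alg_hom K (arrs C) (arrs D) \<inter> extensional (carrier (arrs C)) \<and>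
     F0 \<in> alg_hom K (objs C) (objs D) \<inter> extensional (carrier (objs C)) \<and>
     (\<forall>x\<in>carrier (arrs C). src D (F1 x) = F0 (src C x)) \<and>
     (\<forall>x\<in>carrier (arrs C). tgt D (F1 x) = F0 (tgt C x)) \<and>
     (\<forall>a\<in>carrier (objs C). F1 (unt C a) = unt D (F0 a)) \<and>
     (\<forall>(x, y)\<in>carrier (pullback_alg (arrs C) (src C) (tgt C)).
        F1 (cmp C (x, y)) = cmp D (F1 x, F1 y)) \<and>
     (\<forall>a\<in>carrier (objs C). \<forall>b\<in>carrier (objs C). F1 (twist C a b) = twist D (F0 a) (F0 b))}"

type_synonym ('k, 'c1, 'c0) bicat_cat = "(('k, 'c1, 'c0) bicat, ('c1 \<Rightarrow> 'c1) \<times> ('c0 \<Rightarrow> 'c0)) cat"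

definition BICat :: "('k, 'z) ring_scheme \<Rightarrow> ('k, 'c1, 'c0) bicat_cat" where
  "BICat K = \<lparr>
     Ob = {D. braided_categorical_assoc_algebra K (arrs D) (objs D)
                (src D) (tgt D) (unt D) (cmp D) (twist D)},
     Hom = bicat_hom K,
     Idn = (\<lambda>D. (\<lambda>x\<in>carrier (arrs D). x, \<lambda>a\<in>carrier (objs D). a)),
     Cmp = (\<lambda>C D E (G1, G0) (F1, F0).
       (compose (carrier (arrs C)) G1 F1, compose (carrier (objs C)) G0 F0))\<rparr>"


section \<open>The functors\<close>

text \<open>The semidirect product has ordered pairs as elements, and the composite functors have to be
  endofunctors of one category. A HOL type is in general not closed under pairing, so all
  carriers are taken to be subsets of a type \<open>'u univ\<close>, the free closure of an arbitrary type
  \<open>'u\<close> under ordered pairs; \<open>Elem\<close> embeds any algebra with carrier in \<open>'u\<close>.\<close>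

datatype 'u univ = Elem 'u | Pr (ufst: "'u univ") (usnd: "'u univ")

definition semidirect :: "('k, 'u univ) module \<Rightarrow> ('k, 'u univ) module
    \<Rightarrow> ('u univ \<Rightarrow> 'u univ \<Rightarrow> 'u univ) \<Rightarrow> ('u univ \<Rightarrow> 'u univ \<Rightarrow> 'u univ)
    \<Rightarrow> ('k, 'u univ) module" where
  "semidirect M N l r = \<lparr>
     carrier = {Pr m n | m n. m \<in> carrier M \<and> n \<in> carrier N},
     mult = (\<lambda>x y. Pr
       (ufst x \<otimes>\<^bsub>M\<^esub> ufst y \<oplus>\<^bsub>M\<^esub> l (usnd x) (ufst y) \<oplus>\<^bsub>M\<^esub> r (ufst x) (usnd y))
       (usnd x \<otimes>\<^bsub>N\<^esub> usnd y)),
     one = undefined,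
     zero = Pr \<zero>\<^bsub>M\<^esub> \<zero>\<^bsub>N\<^esub>,
     add = (\<lambda>x y. Pr (ufst x \<oplus>\<^bsub>M\<^esub> ufst y) (usnd x \<oplus>\<^bsub>N\<^esub> usnd y)),
     smult = (\<lambda>a x. Pr (a \<odot>\<^bsub>M\<^esub> ufst x) (a \<odot>\<^bsub>N\<^esub> usnd x))\<rparr>"

definition C_ob :: "('k, 'u univ, 'u univ) bxmod \<Rightarrow> ('k, 'u univ, 'u univ) bicat" where
  "C_ob X = \<lparr>
     arrs = semidirect (xM X) (xN X) (lact X) (ract X),
     objs = xN X,
     src = (\<lambda>x. usnd x),
     tgt = (\<lambda>x. bdry X (ufst x) \<oplus>\<^bsub>xN X\<^esub> usnd x),
     unt = (\<lambda>n. Pr \<zero>\<^bsub>xM X\<^esub> n),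
     cmp = (\<lambda>(x, y). Pr (ufst x \<oplus>\<^bsub>xM X\<^esub> ufst y) (usnd x)),
     twist = (\<lambda>n n'. Pr (\<ominus>\<^bsub>xM X\<^esub> brace X n n') (n \<otimes>\<^bsub>xN X\<^esub> n'))\<rparr>"

definition C_functor ::
  "(('k, 'u univ, 'u univ) bxmod, ('u univ \<Rightarrow> 'u univ) \<times> ('u univ \<Rightarrow> 'u univ),
    ('k, 'u univ, 'u univ) bicat, ('u univ \<Rightarrow> 'u univ) \<times> ('u univ \<Rightarrow> 'u univ)) fctr" where
  "C_functor = \<lparr>on_ob = C_ob,
     on_ar = (\<lambda>X Y (f1, f2).
       (\<lambda>x\<in>carrier (semidirect (xM X) (xN X) (lact X) (ract X)). Pr (f1 (ufst x)) (f2 (usnd x)),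
        f2))\<rparr>"

definition ker_alg :: "('k, 'a) module \<Rightarrow> ('k, 'b) module \<Rightarrow> ('a \<Rightarrow> 'b) \<Rightarrow> ('k, 'a) module" where
  "ker_alg A B f = A\<lparr>carrier := {x \<in> carrier A. f x = \<zero>\<^bsub>B\<^esub>}\<rparr>"

definition X_ob :: "('k, 'c1, 'c0) bicat \<Rightarrow> ('k, 'c1, 'c0) bxmod" where
  "X_ob D = \<lparr>
     xM = ker_alg (arrs D) (objs D) (src D),
     xN = objs D,
     lact = (\<lambda>a x. unt D a \<otimes>\<^bsub>arrs D\<^esub> x),
     ract = (\<lambda>x a. x \<otimes>\<^bsub>arrs D\<^esub> unt D a),
     bdry = restrict (tgt D) (carrier (ker_alg (arrs D) (objs D) (src D))),
     brace = (\<lambda>a b. unt D (a \<otimes>\<^bsub>objs D\<^esub> b) \<ominus>\<^bsub>arrs D\<^esub> twist D a b)\<rparr>"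

definition X_functor ::
  "(('k, 'c1, 'c0) bicat, ('c1 \<Rightarrow> 'c1) \<times> ('c0 \<Rightarrow> 'c0),
    ('k, 'c1, 'c0) bxmod, ('c1 \<Rightarrow> 'c1) \<times> ('c0 \<Rightarrow> 'c0)) fctr" where
  "X_functor = \<lparr>on_ob = X_ob,
     on_ar = (\<lambda>D E (F1, F0).
       (restrict F1 (carrier (ker_alg (arrs D) (objs D) (src D))), F0))\<rparr>"

definition alpha :: "('k, 'u univ, 'u univ) bxmod
    \<Rightarrow> ('u univ \<Rightarrow> 'u univ) \<times> ('u univ \<Rightarrow> 'u univ)" where
  "alpha Z = (\<lambda>m\<in>carrier (xM Z). Pr m \<zero>\<^bsub>xN Z\<^esub>, \<lambda>n\<in>carrier (xN Z). n)"

definition beta :: "('k, 'u univ, 'u univ) bicat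
    \<Rightarrow> ('u univ \<Rightarrow> 'u univ) \<times> ('u univ \<Rightarrow> 'u univ)" where
  "beta D = (\<lambda>x\<in>carrier (arrs D). Pr (x \<ominus>\<^bsub>arrs D\<^esub> unt D (src D x)) (src D x),
             \<lambda>a\<in>carrier (objs D). a)"

end

theory Submission
  imports Defs
begin

text \<open>In a categorical algebra the composition is forced: \<open>k (x, y) = x + y - e (s y)\<close>, because \<open>k\<close> is
  additive and unital. Every axiom about \<open>k\<close> therefore becomes a linear identity. Multiplicativity of
  \<open>k\<close> is the Peiffer identity for \<open>ker s\<close>, and for arrows \<open>x\<close>, \<open>y\<close> of which one has source \<open>0\<close>,
  naturality of the braiding reads \<open>\<tau> (t x) (t y) = y x - x y + e (t x) e (t y)\<close>, which yields the
  three conditions relating the bracket to the boundary map. The isomorphism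
  \<open>\<beta>\<close> has inverse \<open>(m, a) \<mapsto> m + e a\<close>.\<close>

section \<open>Abelian groups, bilinear maps and homomorphisms\<close>

context abelian_group
begin

lemma minus_zero [simp]: "\<ominus> \<zero> = \<zero>"
  by (rule minus_equality) simp_all

lemma diff_self [simp]: "x \<in> carrier G \<Longrightarrow> x \<ominus> x = \<zero>"
  by (simp add: minus_eq r_neg)

lemma diff_zero [simp]: "x \<in> carrier G \<Longrightarrow> x \<ominus> \<zero> = x"
  by (simp add: minus_eq)

lemma diff_add_cancel [simp]: "\<lbrakk>x \<in> carrier G; y \<in> carrier G\<rbrakk> \<Longrightarrow> (x \<ominus> y) \<oplus> y = x"
  by (simp add: minus_eq a_assoc l_neg)

lemma add_diff_cancel [simp]: "\<lbrakk>x \<in> carrier G; y \<in> carrier G\<rbrakk> \<Longrightarrow> (x \<oplus> y) \<ominus> y = x"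
  by (simp add: minus_eq a_assoc r_neg)

lemma zero_diff [simp]: "x \<in> carrier G \<Longrightarrow> \<zero> \<ominus> x = \<ominus> x"
  by (simp add: minus_eq)

lemma
  assumes "x \<in> carrier G" "y \<in> carrier G"
  shows add_neg_eq: "x \<oplus> \<ominus> y = x \<ominus> y"
    and neg_add_eq: "\<ominus> x \<oplus> y = y \<ominus> x"
    and diff_neg_eq: "x \<ominus> (\<ominus> y) = x \<oplus> y"
    and neg_diff_eq: "\<ominus> (x \<ominus> y) = y \<ominus> x"
    and neg_eq_iff: "\<ominus> x = y \<longleftrightarrow> x \<oplus> y = \<zero>"
    and eq_neg_iff: "y = \<ominus> x \<longleftrightarrow> x \<oplus> y = \<zero>"
  using assms by (auto simp: minus_eq a_comm minus_add r_neg intro: minus_equality minus_equality[symmetric])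

lemma
  assumes "x \<in> carrier G" "y \<in> carrier G" "z \<in> carrier G"
  shows add_diff_eq: "x \<oplus> (y \<ominus> z) = (x \<oplus> y) \<ominus> z"
    and diff_add_eq: "(x \<ominus> y) \<oplus> z = (x \<oplus> z) \<ominus> y"
    and diff_diff_eq: "(x \<ominus> y) \<ominus> z = x \<ominus> (y \<oplus> z)"
    and diff_diff_eq2: "x \<ominus> (y \<ominus> z) = (x \<oplus> z) \<ominus> y"
    and diff_eq_eq: "x \<ominus> y = z \<longleftrightarrow> x = z \<oplus> y"
    and eq_diff_eq: "z = x \<ominus> y \<longleftrightarrow> z \<oplus> y = x"
  using assms add.inv_solve_right[of z x y] add.inv_solve_right'[of z x y]
  by (auto simp: minus_eq a_ac minus_add)

text \<open>Moves all subtractions to the outermost position and then across the equality sign, so that an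
  identity of the additive group becomes one between sums.\<close>

lemmas group_simps = add_neg_eq neg_add_eq diff_neg_eq neg_diff_eq neg_eq_iff eq_neg_iff
  add_diff_eq diff_add_eq diff_diff_eq diff_diff_eq2 diff_eq_eq eq_diff_eq a_ac

end

section \<open>Modules and bilinear maps\<close>

lemma (in module) smult_diff:
  "\<lbrakk>a \<in> carrier R; x \<in> carrier M; y \<in> carrier M\<rbrakk>
    \<Longrightarrow> a \<odot>\<^bsub>M\<^esub> (x \<ominus>\<^bsub>M\<^esub> y) = a \<odot>\<^bsub>M\<^esub> x \<ominus>\<^bsub>M\<^esub> a \<odot>\<^bsub>M\<^esub> y"
  by (simp add: a_minus_def smult_r_distr smult_r_minus)

text \<open>As a locale, bilinearity is instantiated once for each multiplication, action, bracket
  and braiding, and every instance brings its laws as simplification rules.\<close>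

locale bilinear = A: module K A + B: module K B + C: module K C
  for K (structure) and A :: "('k, 'a) module" and B :: "('k, 'b) module"
    and C :: "('k, 'c) module" +
  fixes f :: "'a \<Rightarrow> 'b \<Rightarrow> 'c"
  assumes bilinear: "bilinear_map K A B C f"
begin

lemma closed [simp, intro]: "\<lbrakk>x \<in> carrier A; y \<in> carrier B\<rbrakk> \<Longrightarrow> f x y \<in> carrier C"
  using bilinear by (auto simp: bilinear_map_def)

lemma add_left [simp]: "\<lbrakk>x \<in> carrier A; x' \<in> carrier A; y \<in> carrier B\<rbrakk>
    \<Longrightarrow> f (x \<oplus>\<^bsub>A\<^esub> x') y = f x y \<oplus>\<^bsub>C\<^esub> f x' y"
  using bilinear by (auto simp: bilinear_map_def)

lemma add_right [simp]: "\<lbrakk>x \<in> carrier A; y \<in> carrier B; y' \<in> carrier B\<rbrakk>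
    \<Longrightarrow> f x (y \<oplus>\<^bsub>B\<^esub> y') = f x y \<oplus>\<^bsub>C\<^esub> f x y'"
  using bilinear by (auto simp: bilinear_map_def)

lemma smult_left [simp]: "\<lbrakk>a \<in> carrier K; x \<in> carrier A; y \<in> carrier B\<rbrakk>
    \<Longrightarrow> f (a \<odot>\<^bsub>A\<^esub> x) y = a \<odot>\<^bsub>C\<^esub> f x y"
  using bilinear by (auto simp: bilinear_map_def)

lemma smult_right [simp]: "\<lbrakk>a \<in> carrier K; x \<in> carrier A; y \<in> carrier B\<rbrakk>
    \<Longrightarrow> f x (a \<odot>\<^bsub>B\<^esub> y) = a \<odot>\<^bsub>C\<^esub> f x y"
  using bilinear by (auto simp: bilinear_map_def)

lemma zero_left [simp]: "y \<in> carrier B \<Longrightarrow> f \<zero>\<^bsub>A\<^esub> y = \<zero>\<^bsub>C\<^esub>"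
  using add_left[of "\<zero>\<^bsub>A\<^esub>" "\<zero>\<^bsub>A\<^esub>" y] by simp

lemma zero_right [simp]: "x \<in> carrier A \<Longrightarrow> f x \<zero>\<^bsub>B\<^esub> = \<zero>\<^bsub>C\<^esub>"
  using add_right[of x "\<zero>\<^bsub>B\<^esub>" "\<zero>\<^bsub>B\<^esub>"] by simp

lemma minus_left [simp]: "\<lbrakk>x \<in> carrier A; y \<in> carrier B\<rbrakk> \<Longrightarrow> f (\<ominus>\<^bsub>A\<^esub> x) y = \<ominus>\<^bsub>C\<^esub> f x y"
  \<comment> \<open>\<open>add_left\<close> is removed from the simplifier because it would expand
    the left side of this very instance; instead \<open>r_neg\<close> collapses the sum to zero
    there.\<close>
  using add_left[of x "\<ominus>\<^bsub>A\<^esub> x" y]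
  by (simp add: A.M.r_neg C.M.eq_neg_iff del: add_left)

lemma minus_right [simp]: "\<lbrakk>x \<in> carrier A; y \<in> carrier B\<rbrakk> \<Longrightarrow> f x (\<ominus>\<^bsub>B\<^esub> y) = \<ominus>\<^bsub>C\<^esub> f x y"
  using add_right[of x y "\<ominus>\<^bsub>B\<^esub> y"]
  by (simp add: B.M.r_neg C.M.eq_neg_iff del: add_right)

lemma diff_left [simp]: "\<lbrakk>x \<in> carrier A; x' \<in> carrier A; y \<in> carrier B\<rbrakk>
    \<Longrightarrow> f (x \<ominus>\<^bsub>A\<^esub> x') y = f x y \<ominus>\<^bsub>C\<^esub> f x' y"
  by (simp add: a_minus_def)

lemma diff_right [simp]: "\<lbrakk>x \<in> carrier A; y \<in> carrier B; y' \<in> carrier B\<rbrakk>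
    \<Longrightarrow> f x (y \<ominus>\<^bsub>B\<^esub> y') = f x y \<ominus>\<^bsub>C\<^esub> f x y'"
  by (simp add: a_minus_def)

end

lemma bilinear_mapI:
  assumes "\<And>x y. \<lbrakk>x \<in> carrier A; y \<in> carrier B\<rbrakk> \<Longrightarrow> f x y \<in> carrier C"
    and "\<And>x x' y. \<lbrakk>x \<in> carrier A; x' \<in> carrier A; y \<in> carrier B\<rbrakk>
      \<Longrightarrow> f (x \<oplus>\<^bsub>A\<^esub> x') y = f x y \<oplus>\<^bsub>C\<^esub> f x' y"
    and "\<And>x y y'. \<lbrakk>x \<in> carrier A; y \<in> carrier B; y' \<in> carrier B\<rbrakk>
      \<Longrightarrow> f x (y \<oplus>\<^bsub>B\<^esub> y') = f x y \<oplus>\<^bsub>C\<^esub> f x y'"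
    and "\<And>r x y. \<lbrakk>r \<in> carrier K; x \<in> carrier A; y \<in> carrier B\<rbrakk>
      \<Longrightarrow> f (r \<odot>\<^bsub>A\<^esub> x) y = r \<odot>\<^bsub>C\<^esub> f x y"
    and "\<And>r x y. \<lbrakk>r \<in> carrier K; x \<in> carrier A; y \<in> carrier B\<rbrakk>
      \<Longrightarrow> f x (r \<odot>\<^bsub>B\<^esub> y) = r \<odot>\<^bsub>C\<^esub> f x y"
  shows "bilinear_map K A B C f"
  using assms by (auto simp: bilinear_map_def)

sublocale assoc_algebra \<subseteq> mult: bilinear K A A A "mult A"
  by unfold_locales (rule mult_bilinear)

section \<open>Algebra homomorphisms\<close>

lemma alg_hom_add: "\<lbrakk>f \<in> alg_hom K A B; x \<in> carrier A; y \<in> carrier A\<rbrakk>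
    \<Longrightarrow> f (x \<oplus>\<^bsub>A\<^esub> y) = f x \<oplus>\<^bsub>B\<^esub> f y"
  by (auto simp: alg_hom_def)

lemma alg_hom_mult: "\<lbrakk>f \<in> alg_hom K A B; x \<in> carrier A; y \<in> carrier A\<rbrakk>
    \<Longrightarrow> f (x \<otimes>\<^bsub>A\<^esub> y) = f x \<otimes>\<^bsub>B\<^esub> f y"
  by (auto simp: alg_hom_def)

locale algebra_hom = A: assoc_algebra K A + B: assoc_algebra K B
  for K (structure) and A :: "('k, 'a) module" and B :: "('k, 'b) module" +
  fixes f :: "'a \<Rightarrow> 'b"
  assumes hom: "f \<in> alg_hom K A B"
begin

lemma closed [simp, intro]: "x \<in> carrier A \<Longrightarrow> f x \<in> carrier B"
  using hom by (auto simp: alg_hom_def)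

lemma add [simp]: "\<lbrakk>x \<in> carrier A; y \<in> carrier A\<rbrakk> \<Longrightarrow> f (x \<oplus>\<^bsub>A\<^esub> y) = f x \<oplus>\<^bsub>B\<^esub> f y"
  by (rule alg_hom_add[OF hom])

lemma smult [simp]: "\<lbrakk>a \<in> carrier K; x \<in> carrier A\<rbrakk> \<Longrightarrow> f (a \<odot>\<^bsub>A\<^esub> x) = a \<odot>\<^bsub>B\<^esub> f x"
  using hom by (auto simp: alg_hom_def)

lemma mult [simp]: "\<lbrakk>x \<in> carrier A; y \<in> carrier A\<rbrakk> \<Longrightarrow> f (x \<otimes>\<^bsub>A\<^esub> y) = f x \<otimes>\<^bsub>B\<^esub> f y"
  by (rule alg_hom_mult[OF hom])

lemma zero [simp]: "f \<zero>\<^bsub>A\<^esub> = \<zero>\<^bsub>B\<^esub>"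
  using add[of "\<zero>\<^bsub>A\<^esub>" "\<zero>\<^bsub>A\<^esub>"] by simp

lemma minus [simp]: "x \<in> carrier A \<Longrightarrow> f (\<ominus>\<^bsub>A\<^esub> x) = \<ominus>\<^bsub>B\<^esub> f x"
  using add[of x "\<ominus>\<^bsub>A\<^esub> x"] by (simp add: A.M.r_neg B.M.eq_neg_iff del: add)

lemma diff [simp]: "\<lbrakk>x \<in> carrier A; y \<in> carrier A\<rbrakk> \<Longrightarrow> f (x \<ominus>\<^bsub>A\<^esub> y) = f x \<ominus>\<^bsub>B\<^esub> f y"
  by (simp add: a_minus_def)

end

lemma alg_homI:
  assumes "\<And>x. x \<in> carrier A \<Longrightarrow> f x \<in> carrier B"
    and "\<And>x y. \<lbrakk>x \<in> carrier A; y \<in> carrier A\<rbrakk> \<Longrightarrow> f (x \<oplus>\<^bsub>A\<^esub> y) = f x \<oplus>\<^bsub>B\<^esub> f y"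
    and "\<And>r x. \<lbrakk>r \<in> carrier K; x \<in> carrier A\<rbrakk> \<Longrightarrow> f (r \<odot>\<^bsub>A\<^esub> x) = r \<odot>\<^bsub>B\<^esub> f x"
    and "\<And>x y. \<lbrakk>x \<in> carrier A; y \<in> carrier A\<rbrakk> \<Longrightarrow> f (x \<otimes>\<^bsub>A\<^esub> y) = f x \<otimes>\<^bsub>B\<^esub> f y"
  shows "f \<in> alg_hom K A B"
  using assms by (auto simp: alg_hom_def)

section \<open>Structure maps as bilinear maps and homomorphisms\<close>

sublocale assoc_action \<subseteq> l: bilinear K N M M l
  by unfold_locales (rule l_bilinear)
sublocale assoc_action \<subseteq> r: bilinear K M N M r
  by unfold_locales (rule r_bilinear)
sublocale crossed_module \<subseteq> d: algebra_hom K M N d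
  by unfold_locales (rule d_hom)
sublocale braided_crossed_module \<subseteq> br: bilinear K N N M br
  by unfold_locales (rule br_bilinear)
sublocale categorical_assoc_algebra \<subseteq> s: algebra_hom K C1 C0 s
  by unfold_locales (rule s_hom)
sublocale categorical_assoc_algebra \<subseteq> t: algebra_hom K C1 C0 t
  by unfold_locales (rule t_hom)
sublocale categorical_assoc_algebra \<subseteq> e: algebra_hom K C0 C1 e
  by unfold_locales (rule e_hom)
sublocale braided_categorical_assoc_algebra \<subseteq> \<tau>: bilinear K C0 C0 C1 \<tau>
  by unfold_locales (rule \<tau>_bilinear)

section \<open>From crossed modules to categorical algebras\<close>

lemma semidirect_simps [simp]:
  "mult (semidirect M N l r) (Pr m n) (Pr m' n')
    = Pr (m \<otimes>\<^bsub>M\<^esub> m' \<oplus>\<^bsub>M\<^esub> l n m' \<oplus>\<^bsub>M\<^esub> r m n') (n \<otimes>\<^bsub>N\<^esub> n')"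
  "add (semidirect M N l r) (Pr m n) (Pr m' n') = Pr (m \<oplus>\<^bsub>M\<^esub> m') (n \<oplus>\<^bsub>N\<^esub> n')"
  "smult (semidirect M N l r) a (Pr m n) = Pr (a \<odot>\<^bsub>M\<^esub> m) (a \<odot>\<^bsub>N\<^esub> n)"
  "zero (semidirect M N l r) = Pr \<zero>\<^bsub>M\<^esub> \<zero>\<^bsub>N\<^esub>"
  "Pr m n \<in> carrier (semidirect M N l r) \<longleftrightarrow> m \<in> carrier M \<and> n \<in> carrier N"
  by (auto simp: semidirect_def)

text \<open>As a safe elimination rule it turns elements into explicit pairs, on which
  \<open>semidirect_simps\<close> evaluates all operations.\<close>

lemma semidirectE [elim!]:
  assumes "x \<in> carrier (semidirect M N l r)"
  obtains m n where "x = Pr m n" "m \<in> carrier M" "n \<in> carrier N"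
  using assms by (auto simp: semidirect_def)

lemma assoc_algebra_semidirect:
  assumes "assoc_action K M N l r"
  shows "assoc_algebra K (semidirect M N l r)"
proof -
  interpret assoc_action K M N l r by fact
  note distr = M.smult_l_distr M.smult_r_distr M.smult_assoc1
    N.smult_l_distr N.smult_r_distr N.smult_assoc1
  have "abelian_group (semidirect M N l r)"
  proof (rule abelian_groupI)
    fix x assume "x \<in> carrier (semidirect M N l r)"
    then obtain m n where "x = Pr m n" "m \<in> carrier M" "n \<in> carrier N" ..
    then show "\<exists>y\<in>carrier (semidirect M N l r). y \<oplus>\<^bsub>semidirect M N l r\<^esub> x = \<zero>\<^bsub>semidirect M N l r\<^esub>"
      by (intro bexI[of _ "Pr (\<ominus>\<^bsub>M\<^esub> m) (\<ominus>\<^bsub>N\<^esub> n)"]) (auto simp: M.M.l_neg N.M.l_neg)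
  qed (auto simp: M.M.a_ac N.M.a_ac)
  then have module: "module K (semidirect M N l r)"
    by (rule moduleI[OF M.R.is_cring]) (auto simp: distr)
  show ?thesis
  proof (intro assoc_algebra.intro module assoc_algebra_axioms.intro bilinear_mapI)
    \<comment> \<open>A triple product has one term for each choice of the \<open>M\<close>- or
      \<open>N\<close>-component in the three factors. The two pure choices are associativity of
      \<open>M\<close> and of \<open>N\<close>; the six mixed ones correspond to the six action
      axioms.\<close>
    fix x y z
    assume "x \<in> carrier (semidirect M N l r)" "y \<in> carrier (semidirect M N l r)"
      "z \<in> carrier (semidirect M N l r)"
    then show "(x \<otimes>\<^bsub>semidirect M N l r\<^esub> y) \<otimes>\<^bsub>semidirect M N l r\<^esub> z
      = x \<otimes>\<^bsub>semidirect M N l r\<^esub> (y \<otimes>\<^bsub>semidirect M N l r\<^esub> z)"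
      by (auto simp: M.mult_assoc N.mult_assoc l_mult l_r l_l r_r mult_l mult_r M.M.a_ac)
  qed (auto simp: distr M.M.a_ac N.M.a_ac)
qed

text \<open>Negation is not a field of the record but is defined through the carrier, so it has to
  be computed from uniqueness of inverses.\<close>

lemma
  assumes "assoc_action K M N l r" "m \<in> carrier M" "n \<in> carrier N"
  shows minus_semidirect: "\<ominus>\<^bsub>semidirect M N l r\<^esub> Pr m n = Pr (\<ominus>\<^bsub>M\<^esub> m) (\<ominus>\<^bsub>N\<^esub> n)"
    and diff_semidirect: "\<lbrakk>m' \<in> carrier M; n' \<in> carrier N\<rbrakk>
      \<Longrightarrow> Pr m' n' \<ominus>\<^bsub>semidirect M N l r\<^esub> Pr m n = Pr (m' \<ominus>\<^bsub>M\<^esub> m) (n' \<ominus>\<^bsub>N\<^esub> n)"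
proof -
  interpret assoc_action K M N l r by fact
  interpret S: assoc_algebra K "semidirect M N l r"
    by (rule assoc_algebra_semidirect) fact
  show minus: "\<ominus>\<^bsub>semidirect M N l r\<^esub> Pr m n = Pr (\<ominus>\<^bsub>M\<^esub> m) (\<ominus>\<^bsub>N\<^esub> n)"
    using assms by (intro S.M.minus_equality) (auto simp: M.M.l_neg N.M.l_neg)
  show "Pr m' n' \<ominus>\<^bsub>semidirect M N l r\<^esub> Pr m n = Pr (m' \<ominus>\<^bsub>M\<^esub> m) (n' \<ominus>\<^bsub>N\<^esub> n)"
    by (simp add: a_minus_def minus)
qed

section \<open>Composable pairs and the data of the two categories\<close>

lemma pullback_simps [simp]:
  "mult (pullback_alg A s t) (x, y) (x', y') = (x \<otimes>\<^bsub>A\<^esub> x', y \<otimes>\<^bsub>A\<^esub> y')"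
  "add (pullback_alg A s t) (x, y) (x', y') = (x \<oplus>\<^bsub>A\<^esub> x', y \<oplus>\<^bsub>A\<^esub> y')"
  "smult (pullback_alg A s t) a (x, y) = (a \<odot>\<^bsub>A\<^esub> x, a \<odot>\<^bsub>A\<^esub> y)"
  "(x, y) \<in> carrier (pullback_alg A s t) \<longleftrightarrow> x \<in> carrier A \<and> y \<in> carrier A \<and> t x = s y"
  by (auto simp: pullback_alg_def)

lemma pullbackE [elim!]:
  assumes "z \<in> carrier (pullback_alg A s t)"
  obtains x y where "z = (x, y)" "x \<in> carrier A" "y \<in> carrier A" "t x = s y"
  using assms by (auto simp: pullback_alg_def)

lemma C_ob_simps [simp]:
  "arrs (C_ob X) = semidirect (xM X) (xN X) (lact X) (ract X)"
  "objs (C_ob X) = xN X"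
  "src (C_ob X) (Pr m n) = n"
  "tgt (C_ob X) (Pr m n) = bdry X m \<oplus>\<^bsub>xN X\<^esub> n"
  "unt (C_ob X) n = Pr \<zero>\<^bsub>xM X\<^esub> n"
  "cmp (C_ob X) (Pr m n, Pr m' n') = Pr (m \<oplus>\<^bsub>xM X\<^esub> m') n"
  "twist (C_ob X) n n' = Pr (\<ominus>\<^bsub>xM X\<^esub> brace X n n') (n \<otimes>\<^bsub>xN X\<^esub> n')"
  by (simp_all add: C_ob_def)

lemma BX_simps [simp]:
  "X \<in> Ob (BX K) \<longleftrightarrow>
     braided_crossed_module K (xM X) (xN X) (lact X) (ract X) (bdry X) (brace X)"
  "Hom (BX K) = bxmod_hom K"
  "Idn (BX K) X = (\<lambda>m\<in>carrier (xM X). m, \<lambda>n\<in>carrier (xN X). n)"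
  "Cmp (BX K) X Y Z (g1, g2) (f1, f2)
     = (compose (carrier (xM X)) g1 f1, compose (carrier (xN X)) g2 f2)"
  by (simp_all add: BX_def)

lemma BICat_simps [simp]:
  "D \<in> Ob (BICat K) \<longleftrightarrow> braided_categorical_assoc_algebra K (arrs D) (objs D)
     (src D) (tgt D) (unt D) (cmp D) (twist D)"
  "Hom (BICat K) = bicat_hom K"
  "Idn (BICat K) D = (\<lambda>x\<in>carrier (arrs D). x, \<lambda>a\<in>carrier (objs D). a)"
  "Cmp (BICat K) C D E (G1, G0) (F1, F0)
     = (compose (carrier (arrs C)) G1 F1, compose (carrier (objs C)) G0 F0)"
  by (simp_all add: BICat_def)

lemma C_ob_in_BICat:
  assumes "X \<in> Ob (BX K)"
  shows "C_ob X \<in> Ob (BICat K)"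
proof -
  interpret braided_crossed_module K "xM X" "xN X" "lact X" "ract X" "bdry X" "brace X"
    using assms by simp
  interpret S: assoc_algebra K "semidirect (xM X) (xN X) (lact X) (ract X)"
    by (rule assoc_algebra_semidirect) unfold_locales
  note ac = M.M.a_ac N.M.a_ac
  note distr = M.smult_l_distr M.smult_r_distr M.smult_assoc1
    N.smult_l_distr N.smult_r_distr N.smult_assoc1 N.smult_r_minus M.smult_r_minus
  have "categorical_assoc_algebra K (arrs (C_ob X)) (objs (C_ob X))
     (src (C_ob X)) (tgt (C_ob X)) (unt (C_ob X)) (cmp (C_ob X))"
  proof (intro categorical_assoc_algebra.intro categorical_assoc_algebra_axioms.intro)
    show "src (C_ob X) \<in> alg_hom K (arrs (C_ob X)) (objs (C_ob X))"
      by (rule alg_homI) auto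
    \<comment> \<open>By \<open>d_l\<close> and \<open>d_r\<close>, applying \<open>bdry X\<close>
      to the first component of a product gives exactly the terms of (dm + n)(dm' + n') other than
      nn'.\<close>
    show "tgt (C_ob X) \<in> alg_hom K (arrs (C_ob X)) (objs (C_ob X))"
      by (rule alg_homI) (auto simp: d_l d_r distr ac)
    show "unt (C_ob X) \<in> alg_hom K (objs (C_ob X)) (arrs (C_ob X))"
      by (rule alg_homI) auto
    \<comment> \<open>The second arrow of a composable pair has source dm + n. In a product of two
      such arrows the summands dm act on the other kernel part, and the Peiffer identities turn
      these actions into the cross terms of (m + p)(m' + p').\<close>
    show "cmp (C_ob X) \<in> alg_hom K (pullback_alg (arrs (C_ob X)) (src (C_ob X)) (tgt (C_ob X))) (arrs (C_ob X))"
      by (rule alg_homI) (auto simp: distr ac peiffer_l peiffer_r[symmetric])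
  qed (auto simp: ac S.assoc_algebra_axioms N.assoc_algebra_axioms)
  moreover have "braided_categorical_assoc_algebra_axioms K (arrs (C_ob X)) (objs (C_ob X))
     (src (C_ob X)) (tgt (C_ob X)) (unt (C_ob X)) (cmp (C_ob X)) (twist (C_ob X))"
  proof
    show "bilinear_map K (objs (C_ob X)) (objs (C_ob X)) (arrs (C_ob X)) (twist (C_ob X))"
      by (rule bilinear_mapI) (auto simp: distr M.M.minus_add ac)
  next
    \<comment> \<open>Bilinearity splits {dm + n, dm' + n'} into {n, n'} and three terms with a
      boundary argument. \<open>br_d_d\<close>, \<open>br_d_left\<close> and
      \<open>br_d_right\<close> evaluate these to the difference of the first components of xy and
      yx.\<close>
    fix x y
    assume "x \<in> carrier (arrs (C_ob X))" "y \<in> carrier (arrs (C_ob X))"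
    then show "cmp (C_ob X) (x \<otimes>\<^bsub>arrs (C_ob X)\<^esub> y, twist (C_ob X) (tgt (C_ob X) x) (tgt (C_ob X) y))
      = cmp (C_ob X) (twist (C_ob X) (src (C_ob X) x) (src (C_ob X) y), y \<otimes>\<^bsub>arrs (C_ob X)\<^esub> x)"
      by (auto simp: br_d_d br_d_left br_d_right peiffer_l peiffer_r[symmetric] commutator_def
          M.M.group_simps)
  \<comment> \<open>Composition adds first components, so the two laws for the braiding of a product
    are \<open>br_mult_left\<close> and \<open>br_mult_right\<close> up to sign; \<open>d_br\<close>
    gives the target of the braiding.\<close>
  qed (auto simp: d_br commutator_def br_mult_left br_mult_right N.mult_assoc M.M.group_simps N.M.group_simps)
  ultimately show ?thesis
    by (auto intro: braided_categorical_assoc_algebra.intro)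
qed

section \<open>From categorical algebras to crossed modules\<close>

context algebra_hom
begin

lemma ker_alg_simps [simp]:
  "x \<in> carrier (ker_alg A B f) \<longleftrightarrow> x \<in> carrier A \<and> f x = \<zero>\<^bsub>B\<^esub>"
  "mult (ker_alg A B f) = mult A"
  "add (ker_alg A B f) = add A"
  "zero (ker_alg A B f) = zero A"
  "smult (ker_alg A B f) = smult A"
  by (auto simp: ker_alg_def)

lemma abelian_group_ker_alg: "abelian_group (ker_alg A B f)"
proof (rule abelian_groupI)
  fix x assume "x \<in> carrier (ker_alg A B f)"
  then show "\<exists>y\<in>carrier (ker_alg A B f). y \<oplus>\<^bsub>ker_alg A B f\<^esub> x = \<zero>\<^bsub>ker_alg A B f\<^esub>"
    by (intro bexI[of _ "\<ominus>\<^bsub>A\<^esub> x"]) (auto simp: A.M.l_neg)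
qed (auto simp: A.M.a_ac)

text \<open>Shrinking the carrier could change negation, which is defined through it; uniqueness of
  inverses excludes this on the kernel.\<close>

lemma minus_ker_alg [simp]:
  assumes "x \<in> carrier A" "f x = \<zero>\<^bsub>B\<^esub>"
  shows "\<ominus>\<^bsub>ker_alg A B f\<^esub> x = \<ominus>\<^bsub>A\<^esub> x"
  using assms by (intro abelian_group.minus_equality[OF abelian_group_ker_alg]) (auto simp: A.M.l_neg)

lemma diff_ker_alg [simp]:
  "\<lbrakk>y \<in> carrier A; f y = \<zero>\<^bsub>B\<^esub>\<rbrakk> \<Longrightarrow> x \<ominus>\<^bsub>ker_alg A B f\<^esub> y = x \<ominus>\<^bsub>A\<^esub> y"
  by (simp add: a_minus_def)

lemma assoc_algebra_ker_alg: "assoc_algebra K (ker_alg A B f)"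
proof (intro assoc_algebra.intro assoc_algebra_axioms.intro bilinear_mapI)
  show "module K (ker_alg A B f)"
    by (rule moduleI[OF A.R.is_cring abelian_group_ker_alg])
      (auto simp: A.smult_l_distr A.smult_r_distr A.smult_assoc1)
qed (auto simp: A.mult_assoc)

end

section \<open>Composition in a categorical algebra\<close>

context categorical_assoc_algebra
begin

lemma k_closed [simp, intro]:
  "\<lbrakk>x \<in> carrier C1; y \<in> carrier C1; t x = s y\<rbrakk> \<Longrightarrow> k (x, y) \<in> carrier C1"
  using k_hom by (auto simp: alg_hom_def)

lemma k_mult:
  "\<lbrakk>x \<in> carrier C1; y \<in> carrier C1; t x = s y; x' \<in> carrier C1; y' \<in> carrier C1; t x' = s y'\<rbrakk>
    \<Longrightarrow> k (x \<otimes>\<^bsub>C1\<^esub> x', y \<otimes>\<^bsub>C1\<^esub> y') = k (x, y) \<otimes>\<^bsub>C1\<^esub> k (x', y')"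
  using alg_hom_mult[OF k_hom, of "(x, y)" "(x', y')"] by simp

lemma k_add:
  "\<lbrakk>x \<in> carrier C1; y \<in> carrier C1; t x = s y; x' \<in> carrier C1; y' \<in> carrier C1; t x' = s y'\<rbrakk>
    \<Longrightarrow> k (x \<oplus>\<^bsub>C1\<^esub> x', y \<oplus>\<^bsub>C1\<^esub> y') = k (x, y) \<oplus>\<^bsub>C1\<^esub> k (x', y')"
  using alg_hom_add[OF k_hom, of "(x, y)" "(x', y')"] by simp

lemma k_zero: "\<lbrakk>x \<in> carrier C1; s x = \<zero>\<^bsub>C0\<^esub>\<rbrakk> \<Longrightarrow> k (\<zero>\<^bsub>C1\<^esub>, x) = x"
  using k_e_left[of x] by simp

text \<open>The composable pair \<open>(x, y)\<close> is the sum of \<open>(x, e (t x))\<close> and \<open>(0, y - e (s y))\<close>, and the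
  unit laws evaluate \<open>k\<close> on both.\<close>

lemma k_eq:
  assumes "x \<in> carrier C1" "y \<in> carrier C1" "t x = s y"
  shows "k (x, y) = x \<oplus>\<^bsub>C1\<^esub> (y \<ominus>\<^bsub>C1\<^esub> e (s y))"
proof -
  have "k (x \<oplus>\<^bsub>C1\<^esub> \<zero>\<^bsub>C1\<^esub>, e (t x) \<oplus>\<^bsub>C1\<^esub> (y \<ominus>\<^bsub>C1\<^esub> e (s y)))
    = k (x, e (t x)) \<oplus>\<^bsub>C1\<^esub> k (\<zero>\<^bsub>C1\<^esub>, y \<ominus>\<^bsub>C1\<^esub> e (s y))"
    using assms by (intro k_add) (auto simp: s_e)
  moreover have "e (s y) \<oplus>\<^bsub>C1\<^esub> (y \<ominus>\<^bsub>C1\<^esub> e (s y)) = y"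
    using assms by (simp add: C1.M.group_simps)
  ultimately show ?thesis
    using assms k_e_right[of x] by (simp add: k_zero s_e)
qed

text \<open>Apply \<open>k\<close> to the products of \<open>(x, e (t x))\<close> and \<open>(0, y)\<close>.\<close>

lemma
  assumes "x \<in> carrier C1" "y \<in> carrier C1" "s x = \<zero>\<^bsub>C0\<^esub>" "s y = \<zero>\<^bsub>C0\<^esub>"
  shows e_t_mult: "e (t x) \<otimes>\<^bsub>C1\<^esub> y = x \<otimes>\<^bsub>C1\<^esub> y"
    and mult_e_t: "y \<otimes>\<^bsub>C1\<^esub> e (t x) = y \<otimes>\<^bsub>C1\<^esub> x"
  using k_mult[of x "e (t x)" "\<zero>\<^bsub>C1\<^esub>" y] k_mult[of "\<zero>\<^bsub>C1\<^esub>" y x "e (t x)"] assms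
  by (simp_all add: k_e_right k_zero s_e)

end

section \<open>The braided crossed module of a braided categorical algebra\<close>

lemma X_ob_simps [simp]:
  "xM (X_ob D) = ker_alg (arrs D) (objs D) (src D)"
  "xN (X_ob D) = objs D"
  "lact (X_ob D) a x = unt D a \<otimes>\<^bsub>arrs D\<^esub> x"
  "ract (X_ob D) x a = x \<otimes>\<^bsub>arrs D\<^esub> unt D a"
  "bdry (X_ob D) = restrict (tgt D) (carrier (ker_alg (arrs D) (objs D) (src D)))"
  "brace (X_ob D) a b = unt D (a \<otimes>\<^bsub>objs D\<^esub> b) \<ominus>\<^bsub>arrs D\<^esub> twist D a b"
  by (simp_all add: X_ob_def)

lemma X_ob_in_BX:
  assumes "D \<in> Ob (BICat K)"
  shows "X_ob D \<in> Ob (BX K)"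
proof -
  interpret braided_categorical_assoc_algebra K "arrs D" "objs D"
     "src D" "tgt D" "unt D" "cmp D" "twist D"
    using assms by simp
  \<comment> \<open>Objects act through \<open>unt D\<close>, so the action axioms reduce to
    associativity of \<open>arrs D\<close>; by \<open>s_e\<close> the products stay in the kernel of
    \<open>src D\<close>.\<close>
  have action: "assoc_action K (xM (X_ob D)) (xN (X_ob D)) (lact (X_ob D)) (ract (X_ob D))"
  proof (intro assoc_action.intro assoc_action_axioms.intro)
    show "bilinear_map K (xN (X_ob D)) (xM (X_ob D)) (xM (X_ob D)) (lact (X_ob D))"
      by (rule bilinear_mapI) (auto simp: s_e)
    show "bilinear_map K (xM (X_ob D)) (xN (X_ob D)) (xM (X_ob D)) (ract (X_ob D))"
      by (rule bilinear_mapI) (auto simp: s_e)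
  qed (auto simp: C1.mult_assoc s.assoc_algebra_ker_alg C0.assoc_algebra_axioms)
  have crossed: "crossed_module K (xM (X_ob D)) (xN (X_ob D)) (lact (X_ob D)) (ract (X_ob D))
      (bdry (X_ob D))"
  proof (intro crossed_module.intro action crossed_module_axioms.intro)
    show "bdry (X_ob D) \<in> alg_hom K (xM (X_ob D)) (xN (X_ob D))"
      by (rule alg_homI) auto
  qed (auto simp: s_e t_e e_t_mult mult_e_t)
  have natural: "twist D (tgt D x) (tgt D y)
      = y \<otimes>\<^bsub>arrs D\<^esub> x \<ominus>\<^bsub>arrs D\<^esub> x \<otimes>\<^bsub>arrs D\<^esub> y
        \<oplus>\<^bsub>arrs D\<^esub> unt D (tgt D x) \<otimes>\<^bsub>arrs D\<^esub> unt D (tgt D y)"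
    if xy: "x \<in> carrier (arrs D)" "y \<in> carrier (arrs D)"
      and s: "src D x = \<zero>\<^bsub>objs D\<^esub> \<or> src D y = \<zero>\<^bsub>objs D\<^esub>" for x y
  proof -
    \<comment> \<open>A zero source kills both the braiding of the sources and the source of yx. By
      \<open>k_eq\<close> the right side of naturality is then yx, and the left side is xy plus the
      braiding of the targets minus its identity arrow.\<close>
    have "src D y \<otimes>\<^bsub>objs D\<^esub> src D x = \<zero>\<^bsub>objs D\<^esub>" "twist D (src D x) (src D y) = \<zero>\<^bsub>arrs D\<^esub>"
      using xy s by auto
    then have "x \<otimes>\<^bsub>arrs D\<^esub> y \<oplus>\<^bsub>arrs D\<^esub> (twist D (tgt D x) (tgt D y)
        \<ominus>\<^bsub>arrs D\<^esub> unt D (tgt D x) \<otimes>\<^bsub>arrs D\<^esub> unt D (tgt D y)) = y \<otimes>\<^bsub>arrs D\<^esub> x"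
      using \<tau>_natural[OF xy] xy by (simp add: k_eq s_\<tau> t_\<tau>)
    then show ?thesis
      using xy by (simp add: C1.M.group_simps)
  qed
  have "braided_crossed_module_axioms K (xM (X_ob D)) (xN (X_ob D)) (lact (X_ob D)) (ract (X_ob D))
      (bdry (X_ob D)) (brace (X_ob D))"
  proof
    show "bilinear_map K (xN (X_ob D)) (xN (X_ob D)) (xM (X_ob D)) (brace (X_ob D))"
      by (rule bilinear_mapI) (auto simp: s_e s_\<tau> C1.smult_diff C1.M.group_simps)
  next
    fix m m' assume "m \<in> carrier (xM (X_ob D))" "m' \<in> carrier (xM (X_ob D))"
    then show "brace (X_ob D) (bdry (X_ob D) m) (bdry (X_ob D) m') = commutator (xM (X_ob D)) m m'"
      by (auto simp: natural commutator_def C1.M.group_simps)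
  next
    fix m n assume "m \<in> carrier (xM (X_ob D))" "n \<in> carrier (xN (X_ob D))"
    \<comment> \<open>The object \<open>n\<close> is the target of \<open>unt D n\<close>, and
      \<open>natural\<close> needs a zero source for one arrow only, here \<open>m\<close>.\<close>
    moreover from this have "twist D (tgt D m) n = unt D n \<otimes>\<^bsub>arrs D\<^esub> m \<ominus>\<^bsub>arrs D\<^esub> m \<otimes>\<^bsub>arrs D\<^esub> unt D n
        \<oplus>\<^bsub>arrs D\<^esub> unt D (tgt D m) \<otimes>\<^bsub>arrs D\<^esub> unt D n"
      and "twist D n (tgt D m) = m \<otimes>\<^bsub>arrs D\<^esub> unt D n \<ominus>\<^bsub>arrs D\<^esub> unt D n \<otimes>\<^bsub>arrs D\<^esub> m
        \<oplus>\<^bsub>arrs D\<^esub> unt D n \<otimes>\<^bsub>arrs D\<^esub> unt D (tgt D m)"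
      using natural[of m "unt D n"] natural[of "unt D n" m] by (simp_all add: t_e)
    ultimately show "brace (X_ob D) (bdry (X_ob D) m) n
        = \<ominus>\<^bsub>xM (X_ob D)\<^esub> (lact (X_ob D) n m \<ominus>\<^bsub>xM (X_ob D)\<^esub> ract (X_ob D) m n)"
      and "brace (X_ob D) n (bdry (X_ob D) m)
        = lact (X_ob D) n m \<ominus>\<^bsub>xM (X_ob D)\<^esub> ract (X_ob D) m n"
      by (auto simp: s_e C1.M.group_simps)
  next
    fix a b assume "a \<in> carrier (xN (X_ob D))" "b \<in> carrier (xN (X_ob D))"
    then show "bdry (X_ob D) (brace (X_ob D) a b) = commutator (xN (X_ob D)) a b"
      by (auto simp: s_e s_\<tau> t_e t_\<tau> commutator_def)
  next
    \<comment> \<open>\<open>k_eq\<close> writes each composite as the sum of its two arrows minus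
      the identity at the middle object, acb or bac. That identity completes one bracket, and the
      identity at abc completes the other.\<close>
    fix a b c assume "a \<in> carrier (xN (X_ob D))" "b \<in> carrier (xN (X_ob D))" "c \<in> carrier (xN (X_ob D))"
    then show "brace (X_ob D) a (b \<otimes>\<^bsub>xN (X_ob D)\<^esub> c)
        = lact (X_ob D) b (brace (X_ob D) a c) \<oplus>\<^bsub>xM (X_ob D)\<^esub> ract (X_ob D) (brace (X_ob D) a b) c"
      and "brace (X_ob D) (a \<otimes>\<^bsub>xN (X_ob D)\<^esub> b) c
        = lact (X_ob D) a (brace (X_ob D) b c) \<oplus>\<^bsub>xM (X_ob D)\<^esub> ract (X_ob D) (brace (X_ob D) a c) b"
      by (auto simp: s_e t_e s_\<tau> t_\<tau> \<tau>_mult_left \<tau>_mult_right k_eq C1.mult_assoc C0.mult_assoc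
          C1.M.group_simps)
  qed
  with crossed show ?thesis
    by (auto intro: braided_crossed_module.intro)
qed

section \<open>Categories and functors\<close>

text \<open>\<open>compose\<close> and \<open>restrict\<close> return \<open>undefined\<close> off
  the carrier, so the laws at sums and products rely on closure of the carrier of \<open>A\<close>.
  This is where the algebra hypothesis enters.\<close>

lemma alg_hom_compose:
  assumes "assoc_algebra K A" "f \<in> alg_hom K A B" "g \<in> alg_hom K B C"
  shows "compose (carrier A) g f \<in> alg_hom K A C"
proof -
  interpret assoc_algebra K A by fact
  show ?thesis
    using assms(2,3) by (auto simp: alg_hom_def compose_def Pi_iff)
qed

lemma alg_hom_restrict:
  assumes "assoc_algebra K A"
  shows "restrict f (carrier A) \<in> alg_hom K A B \<longleftrightarrow> f \<in> alg_hom K A B"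
proof -
  interpret assoc_algebra K A by fact
  show ?thesis
    by (auto simp: alg_hom_def Pi_iff)
qed

lemma alg_hom_id: "(\<lambda>x. x) \<in> alg_hom K A A"
  by (rule alg_homI) simp_all

lemma alg_hom_closed: "\<lbrakk>f \<in> alg_hom K A B; x \<in> carrier A\<rbrakk> \<Longrightarrow> f x \<in> carrier B"
  by (auto simp: alg_hom_def)

lemma bxmod_hom_iff:
  "(f1, f2) \<in> bxmod_hom K X Y \<longleftrightarrow>
     f1 \<in> alg_hom K (xM X) (xM Y) \<and> f1 \<in> extensional (carrier (xM X)) \<and>
     f2 \<in> alg_hom K (xN X) (xN Y) \<and> f2 \<in> extensional (carrier (xN X)) \<and>
     (\<forall>n\<in>carrier (xN X). \<forall>m\<in>carrier (xM X). f1 (lact X n m) = lact Y (f2 n) (f1 m)) \<and>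
     (\<forall>m\<in>carrier (xM X). \<forall>n\<in>carrier (xN X). f1 (ract X m n) = ract Y (f1 m) (f2 n)) \<and>
     (\<forall>m\<in>carrier (xM X). bdry Y (f1 m) = f2 (bdry X m)) \<and>
     (\<forall>n\<in>carrier (xN X). \<forall>n'\<in>carrier (xN X). f1 (brace X n n') = brace Y (f2 n) (f2 n'))"
  by (auto simp: bxmod_hom_def)

text \<open>Quantifying over the two arrows separately, with composability as a premise, suits
  rewriting better than elements of the pullback.\<close>

lemma bicat_hom_iff:
  "(F1, F0) \<in> bicat_hom K C D \<longleftrightarrow>
     F1 \<in> alg_hom K (arrs C) (arrs D) \<and> F1 \<in> extensional (carrier (arrs C)) \<and>
     F0 \<in> alg_hom K (objs C) (objs D) \<and> F0 \<in> extensional (carrier (objs C)) \<and>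
     (\<forall>x\<in>carrier (arrs C). src D (F1 x) = F0 (src C x)) \<and>
     (\<forall>x\<in>carrier (arrs C). tgt D (F1 x) = F0 (tgt C x)) \<and>
     (\<forall>a\<in>carrier (objs C). F1 (unt C a) = unt D (F0 a)) \<and>
     (\<forall>x\<in>carrier (arrs C). \<forall>y\<in>carrier (arrs C). tgt C x = src C y \<longrightarrow>
        F1 (cmp C (x, y)) = cmp D (F1 x, F1 y)) \<and>
     (\<forall>a\<in>carrier (objs C). \<forall>b\<in>carrier (objs C). F1 (twist C a b) = twist D (F0 a) (F0 b))"
  by (fastforce simp: bicat_hom_def)

section \<open>The two categories\<close>

lemma category_BX:
  fixes K :: "('k, 'z) ring_scheme"
  shows "category (BX K :: ('k, 'm, 'n) bxmod_cat)"
proof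
  fix X :: "('k, 'm, 'n) bxmod" assume "X \<in> Ob (BX K)"
  then interpret braided_crossed_module K "xM X" "xN X" "lact X" "ract X" "bdry X" "brace X"
    by simp
  show "Idn (BX K) X \<in> Hom (BX K) X X"
    by (simp add: bxmod_hom_iff alg_hom_restrict alg_hom_id M.assoc_algebra_axioms N.assoc_algebra_axioms)
next
  fix X Y Z :: "('k, 'm, 'n) bxmod" and f g
  assume X: "X \<in> Ob (BX K)" and f: "f \<in> Hom (BX K) X Y" and g: "g \<in> Hom (BX K) Y Z"
  obtain f1 f2 g1 g2 where fg: "f = (f1, f2)" "g = (g1, g2)"
    by fastforce
  interpret braided_crossed_module K "xM X" "xN X" "lact X" "ract X" "bdry X" "brace X"
    using X by simp
  show "Cmp (BX K) X Y Z g f \<in> Hom (BX K) X Z"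
    using f g unfolding fg
    by (auto simp: bxmod_hom_iff alg_hom_closed compose_eq
        intro: alg_hom_compose M.assoc_algebra_axioms N.assoc_algebra_axioms)
next
  fix X Y :: "('k, 'm, 'n) bxmod" and f
  assume f: "f \<in> Hom (BX K) X Y"
  \<comment> \<open>Composing with an identity yields a function restricted to the carrier; it
    equals \<open>f\<close> because arrows are extensional.\<close>
  then show "Cmp (BX K) X Y Y (Idn (BX K) Y) f = f" "Cmp (BX K) X X Y f (Idn (BX K) X) = f"
    by (cases f; auto simp: bxmod_hom_iff alg_hom_def intro!: Id_compose compose_Id)+
next
  fix W X Y Z :: "('k, 'm, 'n) bxmod" and f g h
  assume "f \<in> Hom (BX K) W X"
  then show "Cmp (BX K) W X Z (Cmp (BX K) X Y Z h g) f = Cmp (BX K) W Y Z h (Cmp (BX K) W X Y g f)"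
    by (cases f; cases g; cases h) (auto simp: bxmod_hom_iff alg_hom_def intro!: compose_assoc[symmetric])
qed

lemma category_BICat:
  fixes K :: "('k, 'z) ring_scheme"
  shows "category (BICat K :: ('k, 'm, 'n) bicat_cat)"
proof
  fix X :: "('k, 'm, 'n) bicat" assume "X \<in> Ob (BICat K)"
  then interpret braided_categorical_assoc_algebra K "arrs X" "objs X"
     "src X" "tgt X" "unt X" "cmp X" "twist X"
    by simp
  show "Idn (BICat K) X \<in> Hom (BICat K) X X"
    by (simp add: bicat_hom_iff alg_hom_restrict alg_hom_id C1.assoc_algebra_axioms C0.assoc_algebra_axioms)
next
  fix X Y Z :: "('k, 'm, 'n) bicat" and f g
  assume X: "X \<in> Ob (BICat K)" and f: "f \<in> Hom (BICat K) X Y" and g: "g \<in> Hom (BICat K) Y Z"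
  obtain f1 f2 g1 g2 where fg: "f = (f1, f2)" "g = (g1, g2)"
    by fastforce
  interpret braided_categorical_assoc_algebra K "arrs X" "objs X"
     "src X" "tgt X" "unt X" "cmp X" "twist X"
    using X by simp
  show "Cmp (BICat K) X Y Z g f \<in> Hom (BICat K) X Z"
    using f g unfolding fg
    by (auto simp: bicat_hom_iff alg_hom_closed compose_eq
        intro: alg_hom_compose C1.assoc_algebra_axioms C0.assoc_algebra_axioms)
next
  fix X Y :: "('k, 'm, 'n) bicat" and f
  assume f: "f \<in> Hom (BICat K) X Y"
  then show "Cmp (BICat K) X Y Y (Idn (BICat K) Y) f = f" "Cmp (BICat K) X X Y f (Idn (BICat K) X) = f"
    by (cases f; auto simp: bicat_hom_iff alg_hom_def intro!: Id_compose compose_Id)+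
next
  fix W X Y Z :: "('k, 'm, 'n) bicat" and f g h
  assume "f \<in> Hom (BICat K) W X"
  then show "Cmp (BICat K) W X Z (Cmp (BICat K) X Y Z h g) f = Cmp (BICat K) W Y Z h (Cmp (BICat K) W X Y g f)"
    by (cases f; cases g; cases h) (auto simp: bicat_hom_iff alg_hom_def intro!: compose_assoc[symmetric])
qed

section \<open>The two functors\<close>

lemma C_functor_simps [simp]:
  "on_ob C_functor = C_ob"
  "on_ar C_functor X Y (f1, f2) =
     (\<lambda>x\<in>carrier (semidirect (xM X) (xN X) (lact X) (ract X)). Pr (f1 (ufst x)) (f2 (usnd x)), f2)"
  by (simp_all add: C_functor_def)

lemma X_functor_simps [simp]:
  "on_ob X_functor = X_ob"
  "on_ar X_functor C D (F1, F0) = (restrict F1 (carrier (ker_alg (arrs C) (objs C) (src C))), F0)"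
  by (simp_all add: X_functor_def)

lemma cat_functor_C_functor:
  fixes K :: "('k, 'z) ring_scheme"
  shows "cat_functor (BX K :: ('k, 'u univ, 'u univ) bxmod_cat) (BICat K) C_functor"
proof (intro cat_functor.intro category_BX category_BICat cat_functor_axioms.intro)
  fix X :: "('k, 'u univ, 'u univ) bxmod" assume "X \<in> Ob (BX K)"
  then show "on_ob C_functor X \<in> Ob (BICat K)"
    using C_ob_in_BICat by simp
next
  fix X Y :: "('k, 'u univ, 'u univ) bxmod" and f
  assume X: "X \<in> Ob (BX K)" and Y: "Y \<in> Ob (BX K)" and f: "f \<in> Hom (BX K) X Y"
  obtain f1 f2 where f_eq: "f = (f1, f2)"
    by fastforce
  interpret X: braided_crossed_module K "xM X" "xN X" "lact X" "ract X" "bdry X" "brace X"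
    using X by simp
  interpret Y: braided_crossed_module K "xM Y" "xN Y" "lact Y" "ract Y" "bdry Y" "brace Y"
    using Y by simp
  interpret f1: algebra_hom K "xM X" "xM Y" f1
    using f by unfold_locales (simp add: f_eq bxmod_hom_iff)
  interpret f2: algebra_hom K "xN X" "xN Y" f2
    using f by unfold_locales (simp add: f_eq bxmod_hom_iff)
  interpret S: assoc_algebra K "semidirect (xM X) (xN X) (lact X) (ract X)"
    by (rule assoc_algebra_semidirect) unfold_locales
  \<comment> \<open>Multiplicativity uses compatibility of \<open>f\<close> with both actions.
    Compatibility with boundary and bracket then yields preservation of targets and
    braiding.\<close>
  have "(\<lambda>x. Pr (f1 (ufst x)) (f2 (usnd x))) \<in> alg_hom K
      (semidirect (xM X) (xN X) (lact X) (ract X)) (semidirect (xM Y) (xN Y) (lact Y) (ract Y))"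
    using f by (intro alg_homI) (auto simp: f_eq bxmod_hom_iff)
  then show "on_ar C_functor X Y f \<in> Hom (BICat K) (on_ob C_functor X) (on_ob C_functor Y)"
    using f by (auto simp: f_eq bxmod_hom_iff bicat_hom_iff alg_hom_restrict S.assoc_algebra_axioms)
next
  fix X :: "('k, 'u univ, 'u univ) bxmod" assume "X \<in> Ob (BX K)"
  show "on_ar C_functor X X (Idn (BX K) X) = Idn (BICat K) (on_ob C_functor X)"
    by (auto intro!: restrict_ext)
next
  fix X Y Z :: "('k, 'u univ, 'u univ) bxmod" and f g
  assume "f \<in> Hom (BX K) X Y"
  then show "on_ar C_functor X Z (Cmp (BX K) X Y Z g f)
      = Cmp (BICat K) (on_ob C_functor X) (on_ob C_functor Y) (on_ob C_functor Z)
          (on_ar C_functor Y Z g) (on_ar C_functor X Y f)"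
    by (cases f; cases g) (auto simp: compose_def bxmod_hom_iff alg_hom_closed intro!: restrict_ext)
qed

lemma cat_functor_X_functor:
  fixes K :: "('k, 'z) ring_scheme"
  shows "cat_functor (BICat K :: ('k, 'c1, 'c0) bicat_cat) (BX K) X_functor"
proof (intro cat_functor.intro category_BX category_BICat cat_functor_axioms.intro)
  fix D :: "('k, 'c1, 'c0) bicat" assume "D \<in> Ob (BICat K)"
  then show "on_ob X_functor D \<in> Ob (BX K)"
    using X_ob_in_BX by simp
next
  fix D E :: "('k, 'c1, 'c0) bicat" and F
  assume D: "D \<in> Ob (BICat K)" and E: "E \<in> Ob (BICat K)" and F: "F \<in> Hom (BICat K) D E"
  obtain F1 F0 where F_eq: "F = (F1, F0)"
    by fastforce
  interpret D: braided_categorical_assoc_algebra K "arrs D" "objs D"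
     "src D" "tgt D" "unt D" "cmp D" "twist D"
    using D by simp
  interpret E: braided_categorical_assoc_algebra K "arrs E" "objs E"
     "src E" "tgt E" "unt E" "cmp E" "twist E"
    using E by simp
  interpret F1: algebra_hom K "arrs D" "arrs E" F1
    using F by unfold_locales (simp add: F_eq bicat_hom_iff)
  interpret F0: algebra_hom K "objs D" "objs E" F0
    using F by unfold_locales (simp add: F_eq bicat_hom_iff)
  \<comment> \<open>\<open>F1\<close> maps kernel to kernel because it commutes with sources and
    \<open>F0\<close> preserves zero.\<close>
  have "F1 \<in> alg_hom K (ker_alg (arrs D) (objs D) (src D)) (ker_alg (arrs E) (objs E) (src E))"
    using F by (intro alg_homI) (auto simp: F_eq bicat_hom_iff)
  then show "on_ar X_functor D E F \<in> Hom (BX K) (on_ob X_functor D) (on_ob X_functor E)"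
    \<comment> \<open>\<open>D.s_e\<close> and \<open>D.s_\<tau>\<close> place the actions and the
      bracket in the kernel, where the restriction of \<open>F1\<close> agrees with
      \<open>F1\<close>.\<close>
    using F by (auto simp: F_eq bxmod_hom_iff bicat_hom_iff alg_hom_restrict
        D.s.assoc_algebra_ker_alg D.s_e D.s_\<tau>)
next
  fix D :: "('k, 'c1, 'c0) bicat" assume "D \<in> Ob (BICat K)"
  show "on_ar X_functor D D (Idn (BICat K) D) = Idn (BX K) (on_ob X_functor D)"
    by (auto simp: ker_alg_def intro!: restrict_ext)
next
  fix C D E :: "('k, 'c1, 'c0) bicat" and F G
  assume "C \<in> Ob (BICat K)" "D \<in> Ob (BICat K)" and F: "F \<in> Hom (BICat K) C D"
  then interpret C: braided_categorical_assoc_algebra K "arrs C" "objs C"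
     "src C" "tgt C" "unt C" "cmp C" "twist C" +
    D: braided_categorical_assoc_algebra K "arrs D" "objs D"
     "src D" "tgt D" "unt D" "cmp D" "twist D"
    by simp_all
  obtain F1 F0 where F_eq: "F = (F1, F0)"
    by fastforce
  interpret F0: algebra_hom K "objs C" "objs D" F0
    using F by unfold_locales (simp add: F_eq bicat_hom_iff)
  show "on_ar X_functor C E (Cmp (BICat K) C D E G F)
      = Cmp (BX K) (on_ob X_functor C) (on_ob X_functor D) (on_ob X_functor E)
          (on_ar X_functor D E G) (on_ar X_functor C D F)"
    using F by (cases G)
      (auto simp: F_eq compose_def bicat_hom_iff alg_hom_closed intro!: restrict_ext)
qed

section \<open>The natural isomorphisms\<close>

lemma cat_functor_id: "category A \<Longrightarrow> cat_functor A A fctr_id"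
  by (simp add: cat_functor_def cat_functor_axioms_def fctr_id_def)

lemma cat_functor_comp:
  assumes "cat_functor A B F" "cat_functor B C G"
  shows "cat_functor A C (fctr_comp G F)"
proof -
  interpret F: cat_functor A B F by fact
  interpret G: cat_functor B C G by fact
  show ?thesis
    by unfold_locales
      (auto simp: fctr_comp_def F.on_ob F.on_ar F.on_Idn F.on_Cmp G.on_ob G.on_ar G.on_Idn G.on_Cmp)
qed

section \<open>The unit\<close>

lemma alpha_hom:
  assumes X: "X \<in> Ob (BX K)"
  shows "alpha X \<in> bxmod_hom K X (X_ob (C_ob X))"
    and "(\<lambda>x\<in>carrier (xM (X_ob (C_ob X))). ufst x, \<lambda>n\<in>carrier (xN X). n)
      \<in> bxmod_hom K (X_ob (C_ob X)) X"
proof -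
  interpret braided_crossed_module K "xM X" "xN X" "lact X" "ract X" "bdry X" "brace X"
    using X by simp
  interpret C: braided_categorical_assoc_algebra K
    "semidirect (xM X) (xN X) (lact X) (ract X)" "xN X"
     "src (C_ob X)" "tgt (C_ob X)" "unt (C_ob X)" "cmp (C_ob X)" "twist (C_ob X)"
    using C_ob_in_BICat[OF X] by simp
  \<comment> \<open>Needed for the new bracket: subtracting the braiding (-{n,n'}, nn') from the
    identity arrow (0, nn') leaves ({n,n'}, 0).\<close>
  note diff = diff_semidirect[OF assoc_action_axioms]
  have "(\<lambda>m. Pr m \<zero>\<^bsub>xN X\<^esub>)
      \<in> alg_hom K (xM X) (ker_alg (semidirect (xM X) (xN X) (lact X) (ract X)) (xN X) (src (C_ob X)))"
    by (rule alg_homI) auto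
  then show "alpha X \<in> bxmod_hom K X (X_ob (C_ob X))"
    by (auto simp: alpha_def bxmod_hom_iff alg_hom_restrict alg_hom_id M.assoc_algebra_axioms
        N.assoc_algebra_axioms diff)
  \<comment> \<open>On the kernel of the source the second components vanish, and with them the
    action terms of the product, so the first projection is multiplicative.\<close>
  have "ufst \<in> alg_hom K
      (ker_alg (semidirect (xM X) (xN X) (lact X) (ract X)) (xN X) (src (C_ob X))) (xM X)"
    by (rule alg_homI) auto
  then show "(\<lambda>x\<in>carrier (xM (X_ob (C_ob X))). ufst x, \<lambda>n\<in>carrier (xN X). n)
      \<in> bxmod_hom K (X_ob (C_ob X)) X"
    by (auto simp: bxmod_hom_iff alg_hom_restrict alg_hom_id C.s.assoc_algebra_ker_alg
        N.assoc_algebra_axioms diff)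
qed

lemma natural_isomorphism_alpha:
  fixes K :: "('k, 'z) ring_scheme"
  shows "natural_isomorphism (BX K :: ('k, 'u univ, 'u univ) bxmod_cat) (BX K)
    fctr_id (fctr_comp X_functor C_functor) alpha"
proof (intro natural_isomorphism.intro cat_functor_id category_BX natural_isomorphism_axioms.intro
    cat_functor_comp[OF cat_functor_C_functor cat_functor_X_functor])
  fix X :: "('k, 'u univ, 'u univ) bxmod" assume X: "X \<in> Ob (BX K)"
  interpret C: braided_categorical_assoc_algebra K
    "semidirect (xM X) (xN X) (lact X) (ract X)" "xN X"
     "src (C_ob X)" "tgt (C_ob X)" "unt (C_ob X)" "cmp (C_ob X)" "twist (C_ob X)"
    using C_ob_in_BICat[OF X] by simp
  show "is_isomorphism (BX K) (on_ob fctr_id X) (on_ob (fctr_comp X_functor C_functor) X) (alpha X)"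
    unfolding is_isomorphism_def
    \<comment> \<open>The second part of \<open>alpha_hom\<close> supplies the inverse;
      \<open>bexI[rotated]\<close> puts membership first, so that this fact determines the
      witness.\<close>
    using alpha_hom[OF X]
    by (auto simp: fctr_id_def fctr_comp_def alpha_def compose_def intro!: bexI[rotated] restrict_ext)
next
  fix X Y :: "('k, 'u univ, 'u univ) bxmod" and f
  assume X: "X \<in> Ob (BX K)" and Y: "Y \<in> Ob (BX K)" and f: "f \<in> Hom (BX K) X Y"
  obtain f1 f2 where f_eq: "f = (f1, f2)"
    by fastforce
  interpret Y: braided_crossed_module K "xM Y" "xN Y" "lact Y" "ract Y" "bdry Y" "brace Y"
    using Y by simp
  interpret C: braided_categorical_assoc_algebra K
    "semidirect (xM X) (xN X) (lact X) (ract X)" "xN X"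
     "src (C_ob X)" "tgt (C_ob X)" "unt (C_ob X)" "cmp (C_ob X)" "twist (C_ob X)"
    using C_ob_in_BICat[OF X] by simp
  \<comment> \<open>At m the two sides are (f1 m, 0) and (f1 m, f2 0), so naturality needs that
    \<open>f2\<close> preserves zero.\<close>
  interpret f2: algebra_hom K "xN X" "xN Y" f2
    using f by unfold_locales (simp add: f_eq bxmod_hom_iff)
  show "Cmp (BX K) (on_ob fctr_id X) (on_ob fctr_id Y) (on_ob (fctr_comp X_functor C_functor) Y)
        (alpha Y) (on_ar fctr_id X Y f)
      = Cmp (BX K) (on_ob fctr_id X) (on_ob (fctr_comp X_functor C_functor) X)
        (on_ob (fctr_comp X_functor C_functor) Y)
        (on_ar (fctr_comp X_functor C_functor) X Y f) (alpha X)"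
    using f by (auto simp: f_eq fctr_id_def fctr_comp_def alpha_def compose_def bxmod_hom_iff
        alg_hom_closed intro!: restrict_ext)
qed

section \<open>The counit\<close>

lemma beta_hom:
  assumes D: "D \<in> Ob (BICat K)"
  shows "beta D \<in> bicat_hom K D (C_ob (X_ob D))"
    and "(\<lambda>x\<in>carrier (arrs (C_ob (X_ob D))). ufst x \<oplus>\<^bsub>arrs D\<^esub> unt D (usnd x), \<lambda>a\<in>carrier (objs D). a)
      \<in> bicat_hom K (C_ob (X_ob D)) D"
proof -
  interpret braided_categorical_assoc_algebra K "arrs D" "objs D"
     "src D" "tgt D" "unt D" "cmp D" "twist D"
    using D by simp
  interpret X: braided_crossed_module K "ker_alg (arrs D) (objs D) (src D)" "objs D"
    "lact (X_ob D)" "ract (X_ob D)" "bdry (X_ob D)" "brace (X_ob D)"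
    using X_ob_in_BX[OF D] by simp
  let ?S = "semidirect (ker_alg (arrs D) (objs D) (src D)) (objs D) (lact (X_ob D)) (ract (X_ob D))"
  interpret S: assoc_algebra K ?S
    by (rule assoc_algebra_semidirect) unfold_locales
  \<comment> \<open>An arrow is the sum of its kernel part x - e(s x) and e(s x). Multiplying out
    two such sums gives the semidirect product formula.\<close>
  have "(\<lambda>x. Pr (x \<ominus>\<^bsub>arrs D\<^esub> unt D (src D x)) (src D x)) \<in> alg_hom K (arrs D) ?S"
    by (rule alg_homI) (auto simp: s_e C1.smult_diff C1.M.group_simps)
  \<comment> \<open>By \<open>k_eq\<close> the kernel part of a composite is the sum of the kernel
    parts, and the kernel part of \<open>twist D a b\<close> is minus the bracket.\<close>
  then show "beta D \<in> bicat_hom K D (C_ob (X_ob D))"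
    by (auto simp: beta_def bicat_hom_iff alg_hom_restrict alg_hom_id C1.assoc_algebra_axioms
        C0.assoc_algebra_axioms s_e t_e s_\<tau> t_\<tau> k_eq C1.M.group_simps C0.M.group_simps)
  have "(\<lambda>x. ufst x \<oplus>\<^bsub>arrs D\<^esub> unt D (usnd x)) \<in> alg_hom K ?S (arrs D)"
    by (rule alg_homI) (auto simp: C1.smult_r_distr C1.M.a_ac)
  then show "(\<lambda>x\<in>carrier (arrs (C_ob (X_ob D))). ufst x \<oplus>\<^bsub>arrs D\<^esub> unt D (usnd x), \<lambda>a\<in>carrier (objs D). a)
      \<in> bicat_hom K (C_ob (X_ob D)) D"
    by (auto simp: bicat_hom_iff alg_hom_restrict alg_hom_id S.assoc_algebra_axioms
        C0.assoc_algebra_axioms s_e t_e s_\<tau> t_\<tau> k_eq C1.M.group_simps C0.M.group_simps)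
qed

lemma natural_isomorphism_beta:
  fixes K :: "('k, 'z) ring_scheme"
  shows "natural_isomorphism (BICat K :: ('k, 'u univ, 'u univ) bicat_cat) (BICat K)
    fctr_id (fctr_comp C_functor X_functor) beta"
proof (intro natural_isomorphism.intro cat_functor_id category_BICat natural_isomorphism_axioms.intro
    cat_functor_comp[OF cat_functor_X_functor cat_functor_C_functor])
  fix D :: "('k, 'u univ, 'u univ) bicat" assume D: "D \<in> Ob (BICat K)"
  interpret braided_categorical_assoc_algebra K "arrs D" "objs D"
     "src D" "tgt D" "unt D" "cmp D" "twist D"
    using D by simp
  show "is_isomorphism (BICat K) (on_ob fctr_id D) (on_ob (fctr_comp C_functor X_functor) D) (beta D)"
    unfolding is_isomorphism_def
    using beta_hom[OF D]
    by (auto simp: fctr_id_def fctr_comp_def beta_def compose_def s_e intro!: bexI[rotated] restrict_ext)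
next
  fix D E :: "('k, 'u univ, 'u univ) bicat" and F
  assume D: "D \<in> Ob (BICat K)" and E: "E \<in> Ob (BICat K)" and F: "F \<in> Hom (BICat K) D E"
  obtain F1 F0 where F_eq: "F = (F1, F0)"
    by fastforce
  interpret D: braided_categorical_assoc_algebra K "arrs D" "objs D"
     "src D" "tgt D" "unt D" "cmp D" "twist D"
    using D by simp
  interpret E: braided_categorical_assoc_algebra K "arrs E" "objs E"
     "src E" "tgt E" "unt E" "cmp E" "twist E"
    using E by simp
  \<comment> \<open>Naturality holds because \<open>F1\<close> is additive and commutes with source
    and unit, hence with taking kernel parts.\<close>
  interpret F1: algebra_hom K "arrs D" "arrs E" F1
    using F by unfold_locales (simp add: F_eq bicat_hom_iff)
  interpret F0: algebra_hom K "objs D" "objs E" F0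
    using F by unfold_locales (simp add: F_eq bicat_hom_iff)
  show "Cmp (BICat K) (on_ob fctr_id D) (on_ob fctr_id E) (on_ob (fctr_comp C_functor X_functor) E)
        (beta E) (on_ar fctr_id D E F)
      = Cmp (BICat K) (on_ob fctr_id D) (on_ob (fctr_comp C_functor X_functor) D)
        (on_ob (fctr_comp C_functor X_functor) E)
        (on_ar (fctr_comp C_functor X_functor) D E F) (beta D)"
    using F by (auto simp: F_eq fctr_id_def fctr_comp_def beta_def compose_def bicat_hom_iff
        D.s_e intro!: restrict_ext)
qed

theorem proposition3p12:
  fixes K :: "('k, 'z) ring_scheme"
  assumes "field K"
  shows "equivalent_categories (BX K :: ('k, 'u univ, 'u univ) bxmod_cat)
           (BICat K :: ('k, 'u univ, 'u univ) bicat_cat) \<and>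
         inverse_equivalences (BX K :: ('k, 'u univ, 'u univ) bxmod_cat)
           (BICat K :: ('k, 'u univ, 'u univ) bicat_cat) C_functor X_functor alpha beta \<and>
         (\<forall>Z \<in> Ob (BX K :: ('k, 'u univ, 'u univ) bxmod_cat).
           carrier (xM (on_ob X_functor (on_ob C_functor Z)))
             = {Pr m \<zero>\<^bsub>xN Z\<^esub> | m. m \<in> carrier (xM Z)})"
proof -
  have "inverse_equivalences (BX K :: ('k, 'u univ, 'u univ) bxmod_cat) (BICat K)
      C_functor X_functor alpha beta"
    by (intro inverse_equivalences.intro inverse_equivalences_axioms.intro cat_functor_C_functor
        cat_functor_X_functor natural_isomorphism_alpha natural_isomorphism_beta)
  \<comment> \<open>The source map of \<open>C_ob Z\<close> is the second projection, so its kernel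
    is the copy (M, 0) of M onto which the unit maps.\<close>
  moreover have "carrier (xM (X_ob (C_ob Z))) = {Pr m \<zero>\<^bsub>xN Z\<^esub> | m. m \<in> carrier (xM Z)}"
    if "Z \<in> Ob (BX K)" for Z :: "('k, 'u univ, 'u univ) bxmod"
  proof -
    interpret braided_crossed_module K "xM Z" "xN Z" "lact Z" "ract Z" "bdry Z" "brace Z"
      using that by simp
    show ?thesis
      by (auto simp: ker_alg_def)
  qed
  ultimately show ?thesis
    unfolding equivalent_categories_def by auto
qed

end
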